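(* Let $\tilde f\in L^2(\frac{dp}{2p},\mathbb R_+)$ be a normalized wave function such that $f(y)$ exists almost everywhere and is integrable. Then for the relativistic black-hole model, $x(y)=-e^{-y}$, $$\bar N^{Th}_{\beta,in}[f]-\bar N_o[f]=\infty\qquad\text{for all }\beta>0,$$ and so $\bar N^{Th}_{\beta,in}[f]$ is always infinite, for all $\beta>0$.
   Context: A wave function $\tilde f\in L^2(\frac{dp}{2p},\mathbb R_+)$ is extended by $0$ to $p<0$ and $f(y)=\frac1{\sqrt{2\pi}}\int_0^\infty\tilde f(p)e^{ipy}\,dp$; normalized means $\int_0^\infty\frac{dp}{2p}|\tilde f(p)|^2=1$. $(U\tilde f)(k)=\frac1{\sqrt{2\pi}}\int_{-\infty}^\infty e^{-ikx(y)}f(y)\,dy$ for $k\in\mathbb R$. $\bar N_o[f]=\int_0^\infty\frac{dk}{2k}|(U\tilde f)(-k)|^2$ is the mean number of spontaneously created particles. The mean number of particles stimulated by an incoming thermal state of temperature $\beta^{-1}$ is $\bar N^{Th}_{\beta,in}[f]=\langle\hat\phi[f]^\dagger\hat\phi[f]\rangle_{\beta,in}$ (thermal mean value in the incoming Fock space of the massless right-moving scalar field $\phi$, with $\hat\phi(y)=\phi(x(y))$), explicitly $$\bar N^{Th}_{\beta,in}[f]=\int_{-\infty}^{+\infty}\frac{dk}{2k}\frac{|(U\tilde f)(k)|^2}{e^{\beta k}-1}=\bar N_o[f]+\int_0^\infty\frac{dk}{2k}\,\frac{1}{e^{\beta k}-1}\big[|(U\tilde f)(k)|^2+|(U\tilde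 f)(-k)|^2\big].$$ The difference $\bar N^{Th}_{\beta,in}[f]-\bar N_o[f]$ means the last integral, also if $\bar N_o[f]$ is infinite. *)

theory Defs
  imports "HOL-Analysis.Analysis"
begin

text \<open>The measure \<open>dp/2p\<close> on the open half-line; its space is \<open>{0<..}\<close>, so values of a wave function
  at \<open>p \<le> 0\<close> never matter.\<close>

definition half_line_measure :: "real measure" where
  "half_line_measure = density (restrict_space lborel {0<..}) (\<lambda>p. ennreal (1 / (2 * p)))"

definition wave_function :: "(real \<Rightarrow> complex) \<Rightarrow> bool" where
  "wave_function ft \<longleftrightarrow>
     ft \<in> borel_measurable half_line_measure \<and>
     integrable half_line_measure (\<lambda>p. (cmod (ft p))\<^sup>2)"

definition normalized :: "(real \<Rightarrow> complex) \<Rightarrow> bool" where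
  "normalized ft \<longleftrightarrow> (\<integral>p. (cmod (ft p))\<^sup>2 \<partial>half_line_measure) = 1"

text \<open>\<open>f(y)\<close> is a Lebesgue integral. Since Isabelle's integral is total (with value \<open>0\<close> for
  non-integrable integrands), existence of \<open>f(y)\<close> is a separate predicate.\<close>

definition position_wave_exists :: "(real \<Rightarrow> complex) \<Rightarrow> real \<Rightarrow> bool" where
  "position_wave_exists ft y \<longleftrightarrow>
     set_integrable lborel {0<..} (\<lambda>p. ft p * exp (\<i> * of_real (p * y)))"

definition position_wave :: "(real \<Rightarrow> complex) \<Rightarrow> real \<Rightarrow> complex" where
  "position_wave ft y =
     of_real (1 / sqrt (2 * pi)) * (LINT p:{0<..}|lborel. ft p * exp (\<i> * of_real (p * y)))"

definition U_transform :: "(real \<Rightarrow> real) \<Rightarrow> (real \<Rightarrow> complex) \<Rightarrow> real \<Rightarrow> complex" where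
  "U_transform x ft k =
     of_real (1 / sqrt (2 * pi)) *
     (LINT y|lborel. exp (- \<i> * of_real (k * x y)) * position_wave ft y)"

text \<open>Particle numbers are integrals of nonnegative functions, hence valued in \<open>[0, \<infinity>]\<close>.\<close>

definition spontaneous_number :: "(real \<Rightarrow> real) \<Rightarrow> (real \<Rightarrow> complex) \<Rightarrow> ennreal" where
  "spontaneous_number x ft =
     (\<integral>\<^sup>+k. ennreal ((cmod (U_transform x ft (- k)))\<^sup>2) \<partial>half_line_measure)"

text \<open>The integrand below is nonnegative because \<open>k\<close> and \<open>e\<^bsup>\<beta>k\<^esup> - 1\<close> have the same sign for
  \<open>\<beta> > 0\<close>; the value at the null point \<open>k = 0\<close> is irrelevant.\<close>

definition thermal_number :: "(real \<Rightarrow> real) \<Rightarrow> real \<Rightarrow> (real \<Rightarrow> complex) \<Rightarrow> ennreal" where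
  "thermal_number x \<beta> ft =
     (\<integral>\<^sup>+k. ennreal (1 / (2 * k) * ((cmod (U_transform x ft k))\<^sup>2 / (exp (\<beta> * k) - 1))) \<partial>lborel)"

text \<open>The difference \<open>thermal_number - spontaneous_number\<close>, given as an integral of its own so that
  it is meaningful when both terms are infinite; see \<open>thermal_number_decomp\<close>.\<close>

definition thermal_excess :: "(real \<Rightarrow> real) \<Rightarrow> real \<Rightarrow> (real \<Rightarrow> complex) \<Rightarrow> ennreal" where
  "thermal_excess x \<beta> ft =
     (\<integral>\<^sup>+k. ennreal (1 / (exp (\<beta> * k) - 1) *
        ((cmod (U_transform x ft k))\<^sup>2 + (cmod (U_transform x ft (- k)))\<^sup>2)) \<partial>half_line_measure)"

definition black_hole_x :: "real \<Rightarrow> real" where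
  "black_hole_x y = - exp (- y)"

lemma nn_integral_half_line_measure:
  assumes [measurable]: "g \<in> borel_measurable borel"
  shows "(\<integral>\<^sup>+k. ennreal (g k) \<partial>half_line_measure) =
    (\<integral>\<^sup>+k. ennreal (1 / (2 * k)) * ennreal (g k) * indicator {0<..} k \<partial>lborel)"
proof -
  have [measurable]: "(\<lambda>p::real. ennreal (1 / (2 * p))) \<in> borel_measurable (restrict_space lborel {0<..})"
    "(\<lambda>p::real. ennreal (g p)) \<in> borel_measurable (restrict_space lborel {0<..})"
    by (intro measurable_restrict_space1; measurable)+
  show ?thesis
    unfolding half_line_measure_def
    by (subst nn_integral_density) (auto simp: nn_integral_restrict_space)
qed

lemma borel_measurable_U_transform:
  assumes [measurable]: "x \<in> borel_measurable borel"
    and int: "integrable lborel (position_wave ft)"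
  shows "U_transform x ft \<in> borel_measurable borel"
proof -
  have [measurable]: "position_wave ft \<in> borel_measurable borel"
    using borel_measurable_integrable[OF int] by simp
  show ?thesis
    unfolding U_transform_def[abs_def] by measurable
qed

lemma thermal_number_decomp:
  assumes "\<beta> > 0" and "x \<in> borel_measurable borel"
    and "integrable lborel (position_wave ft)"
  shows "thermal_number x \<beta> ft = spontaneous_number x ft + thermal_excess x \<beta> ft"
proof -
  define V where "V = U_transform x ft"
  have [measurable]: "V \<in> borel_measurable borel"
    unfolding V_def using assms(2,3) by (rule borel_measurable_U_transform)
  define h where "h k = ennreal (1 / (2 * k) * ((cmod (V k))\<^sup>2 / (exp (\<beta> * k) - 1)))" for k
  have [measurable]: "h \<in> borel_measurable borel"
    unfolding h_def[abs_def] by measurable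
  have "thermal_number x \<beta> ft = (\<integral>\<^sup>+k. h k \<partial>lborel)"
    by (simp add: thermal_number_def h_def V_def)
  also have "\<dots> = (\<integral>\<^sup>+k. h k * indicator {0<..} k + h k * indicator {..<0} k \<partial>lborel)"
    by (intro nn_integral_cong) (auto simp: h_def indicator_def)
  also have "\<dots> = (\<integral>\<^sup>+k. h k * indicator {0<..} k \<partial>lborel) + (\<integral>\<^sup>+k. h k * indicator {..<0} k \<partial>lborel)"
    by (intro nn_integral_add) measurable
  also have "(\<integral>\<^sup>+k. h k * indicator {..<0} k \<partial>lborel) = (\<integral>\<^sup>+k. h (- k) * indicator {..<0} (- k) \<partial>lborel)"
    using nn_integral_real_affine[of "\<lambda>k. h k * indicator {..<0} k" "-1" 0] by simp
  also have "(\<integral>\<^sup>+k. h k * indicator {0<..} k \<partial>lborel) + \<dots>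
     = (\<integral>\<^sup>+k. h k * indicator {0<..} k + h (- k) * indicator {..<0} (- k) \<partial>lborel)"
    by (intro nn_integral_add[symmetric]) measurable
  also have "\<dots> = (\<integral>\<^sup>+k. ennreal (1 / (2 * k)) * ennreal ((cmod (V (- k)))\<^sup>2) * indicator {0<..} k
      + ennreal (1 / (2 * k)) * ennreal (1 / (exp (\<beta> * k) - 1) * ((cmod (V k))\<^sup>2 + (cmod (V (- k)))\<^sup>2))
        * indicator {0<..} k \<partial>lborel)"
  proof (intro nn_integral_cong)
    fix k :: real
    show "h k * indicator {0<..} k + h (- k) * indicator {..<0} (- k) =
      ennreal (1 / (2 * k)) * ennreal ((cmod (V (- k)))\<^sup>2) * indicator {0<..} k
      + ennreal (1 / (2 * k)) * ennreal (1 / (exp (\<beta> * k) - 1) * ((cmod (V k))\<^sup>2 + (cmod (V (- k)))\<^sup>2))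
        * indicator {0<..} k"
    proof (cases "k > 0")
      case True
      define E where "E = exp (\<beta> * k)"
      have E: "E > 1" using True assms(1) by (simp add: E_def)
      define a b where "a = (cmod (V k))\<^sup>2" and "b = (cmod (V (- k)))\<^sup>2"
      have ab: "a \<ge> 0" "b \<ge> 0" by (auto simp: a_def b_def)
      have Ei: "exp (- (\<beta> * k)) = 1 / E" by (simp add: E_def exp_minus field_simps)
      have neg: "1 / (2 * (- k)) * (b / (1 / E - 1)) = 1 / (2 * k) * b + 1 / (2 * k) * (1 / (E - 1) * b)"
        using True E by (simp add: divide_simps) (simp add: algebra_simps)
      have h1: "h k = ennreal (1 / (2 * k) * (a / (E - 1)))" by (simp add: h_def a_def E_def)
      have h2: "h (- k) = ennreal (1 / (2 * k) * b + 1 / (2 * k) * (1 / (E - 1) * b))"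
        unfolding neg[symmetric] by (simp add: h_def b_def Ei)
      have "h k + h (- k) = ennreal (1 / (2 * k) * (a / (E - 1)) + (1 / (2 * k) * b + 1 / (2 * k) * (1 / (E - 1) * b)))"
        unfolding h1 h2 using True E ab by (intro ennreal_plus[symmetric]) auto
      also have "\<dots> = ennreal (1 / (2 * k) * b + 1 / (2 * k) * (1 / (E - 1) * (a + b)))"
        by (rule arg_cong[where f = ennreal]) (simp add: distrib_left add_divide_distrib)
      also have "\<dots> = ennreal (1 / (2 * k) * b) + ennreal (1 / (2 * k) * (1 / (E - 1) * (a + b)))"
        using True E ab by (intro ennreal_plus) auto
      also have "\<dots> = ennreal (1 / (2 * k)) * ennreal b + ennreal (1 / (2 * k)) * ennreal (1 / (E - 1) * (a + b))"
        using True E ab by (subst (1 2) ennreal_mult[symmetric]) auto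
      finally show ?thesis using True by (simp add: a_def b_def E_def)
    qed auto
  qed
  also have "\<dots> = (\<integral>\<^sup>+k. ennreal (1 / (2 * k)) * ennreal ((cmod (V (- k)))\<^sup>2) * indicator {0<..} k \<partial>lborel)
      + (\<integral>\<^sup>+k. ennreal (1 / (2 * k)) * ennreal (1 / (exp (\<beta> * k) - 1) * ((cmod (V k))\<^sup>2 + (cmod (V (- k)))\<^sup>2))
        * indicator {0<..} k \<partial>lborel)"
    by (intro nn_integral_add) measurable
  also have "\<dots> = spontaneous_number x ft + thermal_excess x \<beta> ft"
    unfolding spontaneous_number_def thermal_excess_def V_def[symmetric]
    by (subst (1 2) nn_integral_half_line_measure) simp_all
  finally show ?thesis .
qed

end

theory Submission
  imports Defs "HOL-Complex_Analysis.Complex_Analysis" "HOL-Real_Asymp.Real_Asymp"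
begin

text \<open>Write \<open>V = U_transform black_hole_x ft\<close>. Near \<open>k = 0\<close> the thermal weight behaves like
  \<open>1 / (2\<beta>k\<^sup>2)\<close>, so a finite excess makes \<open>V k / k\<close> square integrable there. Testing \<open>V\<close> against
  \<open>s e\<^bsup>-sk\<^esup> (1 - s k)\<close> with \<open>s = e\<^sup>x\<close>, which has mean \<open>0\<close>, gives a function \<open>h(x)\<close> that is \<open>O(e\<^bsup>-x/2\<^esup>)\<close>
  by weighted AM-GM. On the other hand \<open>h\<close> is a convolution of \<open>f\<close> with an integrable kernel, so it is
  the Fourier integral \<open>\<integral> a(p) e\<^bsup>-ipx\<^esup> dp\<close> of \<open>a = ft \<cdot> K\<close>, where \<open>K\<close> is the Fourier transform of the
  kernel; it is supported on positive frequencies. Such a function cannot decay exponentially on a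
  half-line unless \<open>a = 0\<close>: the one-sided Laplace transform of \<open>h\<close> continues the Cauchy transform of \<open>a\<close>
  across the positive axis, so the Cauchy transform extends to a bounded entire function that tends
  to \<open>0\<close>. As \<open>K\<close> is real-analytic and not identically zero, \<open>ft = 0\<close> almost everywhere,
  contradicting the normalization.\<close>

subsection \<open>Dominated parameter integrals\<close>

text \<open>Dominated convergence for the difference quotients: by the mean value inequality on the
  convex ball, the bound \<open>w\<close> on the derivative also bounds every quotient.\<close>

lemma has_field_derivative_lebesgue_integral:
  fixes f f' :: "complex \<Rightarrow> 'a \<Rightarrow> complex"
  assumes "r > 0"
    and int: "\<And>\<zeta>. \<zeta> \<in> ball z r \<Longrightarrow> integrable M (f \<zeta>)"
    and der: "\<And>\<zeta> x. \<zeta> \<in> ball z r \<Longrightarrow> x \<in> space M \<Longrightarrow> ((\<lambda>\<zeta>. f \<zeta> x) has_field_derivative f' \<zeta> x) (at \<zeta>)"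
    and meas: "f' z \<in> borel_measurable M"
    and w: "integrable M w"
    and bound: "\<And>\<zeta> x. \<zeta> \<in> ball z r \<Longrightarrow> x \<in> space M \<Longrightarrow> cmod (f' \<zeta> x) \<le> w x"
  shows "((\<lambda>\<zeta>. \<integral>x. f \<zeta> x \<partial>M) has_field_derivative (\<integral>x. f' z x \<partial>M)) (at z)"
proof -
  have z: "z \<in> ball z r" using \<open>r > 0\<close> by simp
  let ?q = "\<lambda>\<zeta> x. (f \<zeta> x - f z x) / (\<zeta> - z)"
  \<comment> \<open>Restricting the limit to the ball keeps every test sequence where integrability
    and the bound \<open>w\<close> are available; the ball is open, so the limit at \<open>z\<close>
    is the same.\<close>
  have "((\<lambda>\<zeta>. \<integral>x. ?q \<zeta> x \<partial>M) \<longlongrightarrow> (\<integral>x. f' z x \<partial>M)) (at z within ball z r)"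
    unfolding tendsto_at_iff_sequentially comp_def
  proof (intro allI impI)
    fix X :: "nat \<Rightarrow> complex"
    assume X: "\<forall>i. X i \<in> ball z r - {z}" and lim: "X \<longlonglongrightarrow> z"
    show "(\<lambda>n. \<integral>x. ?q (X n) x \<partial>M) \<longlonglongrightarrow> (\<integral>x. f' z x \<partial>M)"
    proof (rule integral_dominated_convergence[OF meas _ w])
      show "?q (X n) \<in> borel_measurable M" for n
        using int[OF z] int[of "X n"] X by (intro borel_measurable_divide borel_measurable_diff) auto
      show "AE x in M. (\<lambda>n. ?q (X n) x) \<longlonglongrightarrow> f' z x"
      proof (intro AE_I2)
        fix x assume x: "x \<in> space M"
        have "((\<lambda>\<zeta>. ?q \<zeta> x) \<longlongrightarrow> f' z x) (at z)"
          using der[OF z x] by (simp add: has_field_derivative_iff)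
        moreover have "filterlim X (at z) sequentially"
          using lim X by (auto simp: filterlim_at)
        ultimately show "(\<lambda>n. ?q (X n) x) \<longlonglongrightarrow> f' z x"
          by (rule filterlim_compose)
      qed
      show "AE x in M. norm (?q (X n) x) \<le> w x" for n
      proof (intro AE_I2)
        fix x assume x: "x \<in> space M"
        have "norm (f (X n) x - f z x) \<le> w x * norm (X n - z)"
          using X z x
          by (intro field_differentiable_bound[where S = "ball z r" and f' = "\<lambda>\<zeta>. f' \<zeta> x"]
              bound has_field_derivative_at_within[OF der] convex_ball) auto
        then show "norm (?q (X n) x) \<le> w x"
          using X by (simp add: norm_divide divide_le_eq)
      qed
    qed
  qed
  then have "((\<lambda>\<zeta>. \<integral>x. ?q \<zeta> x \<partial>M) \<longlongrightarrow> (\<integral>x. f' z x \<partial>M)) (at z)"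
    using tendsto_within_open[OF z open_ball] by blast
  moreover have "\<forall>\<^sub>F \<zeta> in at z. (\<integral>x. ?q \<zeta> x \<partial>M) = ((\<integral>x. f \<zeta> x \<partial>M) - (\<integral>x. f z x \<partial>M)) / (\<zeta> - z)"
    unfolding eventually_at
    using \<open>r > 0\<close> int z by (intro exI[of _ r]) (simp add: dist_commute)
  ultimately show ?thesis
    unfolding has_field_derivative_iff by (rule Lim_transform_eventually)
qed

text \<open>The product majorant is integrable on the plane, hence so is \<open>h\<close>, and
  Fubini applies. This form serves every later exchange of integrals.\<close>

lemma Fubini_dominated:
  fixes f :: "real \<Rightarrow> complex" and g :: "real \<Rightarrow> real" and h :: "real \<Rightarrow> real \<Rightarrow> complex"
  assumes f: "integrable lborel f" and g: "integrable lborel g"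
    and meas: "(\<lambda>(x, y). h x y) \<in> borel_measurable (lborel \<Otimes>\<^sub>M lborel)"
    and bound: "\<And>x y. cmod (h x y) \<le> cmod (f x) * g y"
  shows "(\<integral>y. (\<integral>x. h x y \<partial>lborel) \<partial>lborel) = (\<integral>x. (\<integral>y. h x y \<partial>lborel) \<partial>lborel)"
proof -
  have [measurable]: "f \<in> borel_measurable borel" "g \<in> borel_measurable borel"
    using f g by auto
  have "integrable (lborel \<Otimes>\<^sub>M lborel) (\<lambda>z. case z of (x, y) \<Rightarrow> cmod (f x) * g y)"
  proof (rule lborel_pair.Fubini_integrable)
    show "integrable lborel (\<lambda>x. \<integral>y. norm (case (x, y) of (x, y) \<Rightarrow> cmod (f x) * g y) \<partial>lborel)"
      using f by (simp add: abs_mult)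
    show "AE x in lborel. integrable lborel (\<lambda>y. case (x, y) of (x, y) \<Rightarrow> cmod (f x) * g y)"
      using g by simp
  qed measurable
  then have "integrable (lborel \<Otimes>\<^sub>M lborel) (\<lambda>(x, y). h x y)"
    by (rule Bochner_Integration.integrable_bound[OF _ meas])
       (auto intro!: order_trans[OF bound] simp: split_beta)
  then show "(\<integral>y. (\<integral>x. h x y \<partial>lborel) \<partial>lborel) = (\<integral>x. (\<integral>y. h x y \<partial>lborel) \<partial>lborel)"
    by (rule lborel_pair.Fubini_integral)
qed

section \<open>Exponential integrals on the half-line and the line\<close>

lemma set_integrable_exp_neg:
  fixes c :: real
  assumes "c > 0"
  shows "set_integrable lborel {0<..} (\<lambda>x. exp (- c * x))"
proof -
  have "set_integrable lborel {0..} (\<lambda>x. exp (- c * x))"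
    unfolding set_integrable_def
  proof (rule integrableI_bounded)
    have lim: "((\<lambda>x. - (exp (- c * x) / c)) \<longlongrightarrow> - (0 / c)) at_top"
      using \<open>c > 0\<close>
      by (intro tendsto_minus tendsto_divide tendsto_const filterlim_compose[OF exp_at_bot]
            filterlim_tendsto_neg_mult_at_bot[OF tendsto_const] filterlim_ident) auto
    have "(\<integral>\<^sup>+x. ennreal (norm (indicator {0..} x *\<^sub>R exp (- c * x))) \<partial>lborel) =
        (\<integral>\<^sup>+x. ennreal (exp (- c * x)) * indicator {0..} x \<partial>lborel)"
      by (intro nn_integral_cong) (auto simp: indicator_def)
    also have "\<dots> = ennreal (- (0 / c) - - (exp (- c * 0) / c))"
      by (rule nn_integral_FTC_atLeast[OF _ _ _ lim])
         (use \<open>c > 0\<close> in \<open>auto intro!: derivative_eq_intros\<close>)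
    finally show "(\<integral>\<^sup>+x. ennreal (norm (indicator {0..} x *\<^sub>R exp (- c * x))) \<partial>lborel) < \<infinity>"
      by simp
  qed measurable
  then show ?thesis
    by (rule set_integrable_subset) auto
qed

lemma integral_half_line_FTC:
  fixes F f :: "real \<Rightarrow> complex"
  assumes "\<And>x. (F has_vector_derivative f x) (at x)"
    and cont: "continuous_on UNIV f"
    and "set_integrable lborel {0<..} f"
    and "(F \<longlongrightarrow> 0) at_top"
  shows "(LINT x:{0<..}|lborel. f x) = - F 0"
proof -
  have "isCont F 0"
    using assms(1)[of 0] by (rule has_vector_derivative_continuous)
  then have "((F \<circ> real_of_ereal) \<longlongrightarrow> F 0) (at_right (ereal 0))"
    unfolding ereal_tendsto_simps1 isCont_def by (rule filterlim_mono[OF _ order_refl at_le]) auto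
  moreover have "((F \<circ> real_of_ereal) \<longlongrightarrow> 0) (at_left \<infinity>)"
    unfolding ereal_tendsto_simps1 by (rule assms)
  ultimately have "(LBINT x=ereal 0..\<infinity>. f x) = 0 - F 0"
    using assms(1,3) cont by (intro interval_integral_FTC_integrable[where F = F])
      (simp_all add: continuous_on_eq_continuous_at)
  then show ?thesis
    by (simp add: interval_lebesgue_integral_def)
qed

lemma exp_complex_tendsto_0_at_top:
  assumes "Re w > 0"
  shows "((\<lambda>x. exp (- w * of_real x)) \<longlongrightarrow> 0) at_top"
    and "((\<lambda>x. of_real x * exp (- w * of_real x)) \<longlongrightarrow> 0) at_top"
proof -
  have lim: "((\<lambda>x. exp (- Re w * x)) \<longlongrightarrow> 0) at_top"
    "((\<lambda>x. \<bar>x\<bar> * exp (- Re w * x)) \<longlongrightarrow> 0) at_top"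
    using assms by real_asymp+
  show "((\<lambda>x. exp (- w * of_real x)) \<longlongrightarrow> 0) at_top"
    "((\<lambda>x. of_real x * exp (- w * of_real x)) \<longlongrightarrow> 0) at_top"
    by (rule tendsto_norm_zero_cancel, use lim in \<open>simp add: norm_mult\<close>)+
qed

lemma integral_exp_half_line:
  assumes "Re w > 0"
  shows "(LINT x:{0<..}|lborel. exp (- w * of_real x)) = 1 / w"
proof -
  have "w \<noteq> 0" using assms by auto
  have "(LINT x:{0<..}|lborel. exp (- w * of_real x)) = - (- exp (- w * of_real 0) / w)"
  proof (rule integral_half_line_FTC[where F = "\<lambda>x. - exp (- w * of_real x) / w"])
    show "((\<lambda>x. - exp (- w * of_real x) / w) has_vector_derivative exp (- w * of_real x)) (at x)" for x
      using \<open>w \<noteq> 0\<close> by (auto intro!: derivative_eq_intros has_vector_derivative_real_field)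
    show "set_integrable lborel {0<..} (\<lambda>x. exp (- w * of_real x))"
      unfolding set_integrable_def
      by (rule Bochner_Integration.integrable_bound[OF set_integrable_exp_neg[OF assms, unfolded set_integrable_def]])
         auto
    have "((\<lambda>x. - exp (- w * of_real x) / w) \<longlongrightarrow> - 0 / w) at_top"
      using \<open>w \<noteq> 0\<close> by (intro tendsto_intros exp_complex_tendsto_0_at_top assms)
    then show "((\<lambda>x. - exp (- w * of_real x) / w) \<longlongrightarrow> 0) at_top" by simp
  qed (intro continuous_intros)
  then show ?thesis by simp
qed

lemma integral_exp_neg_half_line:
  fixes c :: real
  assumes "c > 0"
  shows "(LINT x:{0<..}|lborel. exp (- c * x)) = 1 / c"
proof -
  have "complex_of_real (LINT x:{0<..}|lborel. exp (- c * x)) = of_real (1 / c)"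
    using integral_exp_half_line[of "of_real c"] assms
    by (simp add: set_integral_complex_of_real[symmetric] flip: exp_of_real)
  then show ?thesis by (simp only: of_real_eq_iff)
qed

lemma integrable_exp_neg_abs:
  fixes c :: real
  assumes "c > 0"
  shows "integrable lborel (\<lambda>v. exp (- c * \<bar>v\<bar>))"
proof -
  let ?e = "\<lambda>x. indicator {0<..} x *\<^sub>R exp (- c * x)"
  have e: "integrable lborel ?e"
    using set_integrable_exp_neg[OF assms] by (simp add: set_integrable_def)
  have "integrable lborel (\<lambda>v. ?e v + ?e (0 + -1 * v))"
    by (intro Bochner_Integration.integrable_add e lborel_integrable_real_affine) simp
  moreover have "AE v in lborel. exp (- c * \<bar>v\<bar>) = ?e v + ?e (0 + -1 * v)"
    using AE_lborel_singleton[of 0] by eventually_elim (auto simp: indicator_def)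
  ultimately show ?thesis
    by (subst integrable_cong_AE) auto
qed

section \<open>Fourier-Laplace transforms of exponentially decaying functions in a strip\<close>

context
  fixes m :: "real \<Rightarrow> complex" and C c :: real
  assumes m [measurable]: "m \<in> borel_measurable borel"
    and m_bound: "\<And>v. cmod (m v) \<le> C * exp (- c * \<bar>v\<bar>)"
begin

private lemma C_nonneg: "C \<ge> 0"
  using order_trans[OF norm_ge_zero m_bound[of 0]] by simp

text \<open>The exponential has modulus \<open>exp (- Im z * v)\<close>, so it costs at most
  \<open>\<bar>Im z\<bar>\<close> of the decay rate \<open>c\<close>.\<close>

private lemma integrand_bound:
  assumes "\<epsilon> \<le> c - \<bar>Im z\<bar>"
  shows "cmod (m v * exp (\<i> * z * of_real v)) \<le> C * exp (- \<epsilon> * \<bar>v\<bar>)"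
proof -
  have "- Im z * v \<le> \<bar>Im z\<bar> * \<bar>v\<bar>"
    using abs_ge_self[of "- Im z * v"] by (simp add: abs_mult)
  moreover have "\<epsilon> * \<bar>v\<bar> \<le> (c - \<bar>Im z\<bar>) * \<bar>v\<bar>"
    using assms by (rule mult_right_mono) simp
  ultimately have le: "- c * \<bar>v\<bar> + - Im z * v \<le> - \<epsilon> * \<bar>v\<bar>"
    by (simp add: algebra_simps)
  have "cmod (m v * exp (\<i> * z * of_real v)) \<le> C * exp (- c * \<bar>v\<bar>) * exp (- Im z * v)"
    using m_bound[of v] by (simp add: norm_mult mult_right_mono)
  also have "\<dots> = C * exp (- c * \<bar>v\<bar> + - Im z * v)"
    by (simp only: exp_add mult.assoc)
  also have "\<dots> \<le> C * exp (- \<epsilon> * \<bar>v\<bar>)"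
    using le C_nonneg by (intro mult_left_mono) auto
  finally show ?thesis .
qed

lemma integrable_Fourier_Laplace:
  assumes "\<bar>Im z\<bar> < c"
  shows "integrable lborel (\<lambda>v. m v * exp (\<i> * z * of_real v))"
proof (rule Bochner_Integration.integrable_bound)
  show "integrable lborel (\<lambda>v. C * exp (- (c - \<bar>Im z\<bar>) * \<bar>v\<bar>))"
    using assms by (intro integrable_mult_right integrable_exp_neg_abs) simp
  show "AE v in lborel. norm (m v * exp (\<i> * z * of_real v)) \<le> norm (C * exp (- (c - \<bar>Im z\<bar>) * \<bar>v\<bar>))"
    using integrand_bound[of "c - \<bar>Im z\<bar>" z] C_nonneg by (simp add: abs_mult)
qed measurable

lemma norm_Fourier_Laplace_le:
  assumes "\<epsilon> > 0" "\<epsilon> \<le> c - \<bar>Im z\<bar>"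
  shows "cmod (\<integral>v. m v * exp (\<i> * z * of_real v) \<partial>lborel) \<le> C * (\<integral>v. exp (- \<epsilon> * \<bar>v\<bar>) \<partial>lborel)"
proof -
  have "cmod (\<integral>v. m v * exp (\<i> * z * of_real v) \<partial>lborel)
      \<le> (\<integral>v. cmod (m v * exp (\<i> * z * of_real v)) \<partial>lborel)"
    by (rule integral_norm_bound)
  also have "\<dots> \<le> (\<integral>v. C * exp (- \<epsilon> * \<bar>v\<bar>) \<partial>lborel)"
    using assms integrable_Fourier_Laplace[of z]
    by (intro integral_mono integrable_norm integrable_mult_right integrable_exp_neg_abs integrand_bound) auto
  finally show ?thesis by simp
qed

lemma holomorphic_on_Fourier_Laplace:
  "(\<lambda>z. \<integral>v. m v * exp (\<i> * z * of_real v) \<partial>lborel) holomorphic_on {z. \<bar>Im z\<bar> < c}"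
  unfolding holomorphic_on_def
proof (intro ballI)
  fix z assume z: "z \<in> {z. \<bar>Im z\<bar> < c}"
  \<comment> \<open>A third of the distance to the edge of the strip: on the ball of radius
    \<open>r\<close> a decay rate of at least \<open>2 * r\<close> survives. One \<open>r\<close> of
    it absorbs the factor \<open>\<bar>v\<bar>\<close> produced by differentiation, the other keeps
    the majorant integrable.\<close>
  define r where "r = (c - \<bar>Im z\<bar>) / 3"
  have "r > 0" using z by (simp add: r_def)
  have Im_le: "2 * r \<le> c - \<bar>Im \<zeta>\<bar>" if "\<zeta> \<in> ball z r" for \<zeta>
    using abs_Im_le_cmod[of "z - \<zeta>"] that by (simp add: dist_norm r_def)
  have "((\<lambda>\<zeta>. \<integral>v. m v * exp (\<i> * \<zeta> * of_real v) \<partial>lborel) has_field_derivative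
      (\<integral>v. (\<i> * of_real v) * (m v * exp (\<i> * z * of_real v)) \<partial>lborel)) (at z)"
  proof (rule has_field_derivative_lebesgue_integral[OF \<open>r > 0\<close>,
        where w = "\<lambda>v. C * exp (- r * \<bar>v\<bar>) / r"])
    fix \<zeta> assume \<zeta>: "\<zeta> \<in> ball z r"
    show "integrable lborel (\<lambda>v. m v * exp (\<i> * \<zeta> * of_real v))"
      using Im_le[OF \<zeta>] \<open>r > 0\<close> by (intro integrable_Fourier_Laplace) auto
    fix v :: real
    show "((\<lambda>\<zeta>. m v * exp (\<i> * \<zeta> * of_real v)) has_field_derivative
       (\<i> * of_real v) * (m v * exp (\<i> * \<zeta> * of_real v))) (at \<zeta>)"
      by (auto intro!: derivative_eq_intros)
    have "r * \<bar>v\<bar> \<le> exp (r * \<bar>v\<bar>)" using exp_ge_add_one_self[of "r * \<bar>v\<bar>"] by linarith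
    then have v: "\<bar>v\<bar> \<le> exp (r * \<bar>v\<bar>) / r" using \<open>r > 0\<close> by (simp add: field_simps)
    have "cmod ((\<i> * of_real v) * (m v * exp (\<i> * \<zeta> * of_real v)))
        = \<bar>v\<bar> * cmod (m v * exp (\<i> * \<zeta> * of_real v))"
      by (simp add: norm_mult)
    also have "\<dots> \<le> \<bar>v\<bar> * (C * exp (- (2 * r) * \<bar>v\<bar>))"
      by (intro mult_left_mono integrand_bound Im_le \<zeta>) auto
    also have "\<dots> \<le> exp (r * \<bar>v\<bar>) / r * (C * exp (- (2 * r) * \<bar>v\<bar>))"
      using v C_nonneg by (intro mult_right_mono) auto
    also have "\<dots> = C * (exp (r * \<bar>v\<bar>) * exp (- (2 * r) * \<bar>v\<bar>)) / r"
      by simp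
    also have "\<dots> = C * exp (- r * \<bar>v\<bar>) / r"
      by (simp only: exp_add[symmetric]) simp
    finally show "cmod ((\<i> * of_real v) * (m v * exp (\<i> * \<zeta> * of_real v))) \<le> C * exp (- r * \<bar>v\<bar>) / r" .
  qed (use integrable_exp_neg_abs[OF \<open>r > 0\<close>] in auto)
  then show "(\<lambda>z. \<integral>v. m v * exp (\<i> * z * of_real v) \<partial>lborel) field_differentiable at z within {z. \<bar>Im z\<bar> < c}"
    unfolding field_differentiable_def by (auto intro: has_field_derivative_at_within)
qed

end

subsection \<open>Cauchy transforms\<close>

text \<open>The Borel sets over which \<open>a\<close> integrates to 0 contain the compact intervals
  and are closed under complements and countable disjoint unions, hence are all Borel sets. The
  complement step needs the total integral to vanish, which follows by exhausting the line by the
  intervals from -n to n.\<close>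

lemma AE_eq_0_if_interval_integrals_0:
  fixes a :: "real \<Rightarrow> complex"
  assumes a: "integrable lborel a"
    and zero: "\<And>\<alpha> \<beta>. \<alpha> \<le> \<beta> \<Longrightarrow> (LINT p:{\<alpha>..\<beta>}|lborel. a p) = 0"
  shows "AE p in lborel. a p = 0"
proof (rule sigma_finite_measure.density_zero[OF lborel.sigma_finite_measure_axioms a])
  have set_int: "set_integrable lborel B a" if "B \<in> sets borel" for B
    unfolding set_integrable_def using that a by (intro integrable_mult_indicator) auto
  have [measurable]: "a \<in> borel_measurable borel" using a by auto
  have "(\<lambda>n. LINT p:{- real n..real n}|lborel. a p) \<longlonglongrightarrow> (\<integral>p. a p \<partial>lborel)"
    unfolding set_lebesgue_integral_def
  proof (rule integral_dominated_convergence[where w = "\<lambda>p. norm (a p)"])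
    show "AE p in lborel. (\<lambda>n. indicator {- real n..real n} p *\<^sub>R a p) \<longlonglongrightarrow> a p"
    proof (intro AE_I2)
      fix p :: real
      obtain N where N: "\<bar>p\<bar> \<le> real N" using real_arch_simple by blast
      have "\<forall>\<^sub>F n in sequentially. indicator {- real n..real n} p *\<^sub>R a p = a p"
        using eventually_ge_at_top[of N]
        by eventually_elim (use N in \<open>auto simp: indicator_def abs_le_iff\<close>)
      then show "(\<lambda>n. indicator {- real n..real n} p *\<^sub>R a p) \<longlonglongrightarrow> a p"
        by (rule tendsto_eventually)
    qed
  qed (use a in \<open>auto simp: indicator_def\<close>)
  then have total: "(\<integral>p. a p \<partial>lborel) = 0"
    by (simp add: zero LIMSEQ_const_iff)
  fix A :: "real set" assume "A \<in> sets lborel"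
  then have "A \<in> sets borel" by simp
  then show "(LINT p:A|lborel. a p) = 0"
  proof (induction A rule: borel_set_induct)
    case (interval \<alpha> \<beta>)
    then show ?case by (rule zero)
  next
    case (compl A)
    have "(LINT p:A \<union> - A|lborel. a p) = (LINT p:A|lborel. a p) + (LINT p:- A|lborel. a p)"
      using compl by (intro set_integral_Un set_int) auto
    moreover have "(LINT p:A \<union> - A|lborel. a p) = 0"
      using total by (simp add: set_lebesgue_integral_def)
    ultimately show ?case using compl by simp
  next
    case (union f)
    have "(LINT p:(\<Union>i. f i)|lborel. a p) = (\<Sum>i. LINT p:f i|lborel. a p)"
      using union by (intro lebesgue_integral_countable_add set_int) (auto simp: disjoint_family_on_def)
    then show ?case using union by simp
  qed (simp add: set_lebesgue_integral_def)
qed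

text \<open>Stieltjes inversion: the jump of the Cauchy transform across the real axis is a Poisson
  integral of \<open>a\<close>. Integrated over an interval and taken to height 0, it yields the
  integral of \<open>a\<close> over that interval.\<close>

lemma AE_eq_0_if_Cauchy_transform_0:
  fixes a :: "real \<Rightarrow> complex"
  assumes a: "integrable lborel a"
    and zero: "\<And>\<zeta>. Im \<zeta> \<noteq> 0 \<Longrightarrow> (\<integral>p. a p / (\<zeta> - of_real p) \<partial>lborel) = 0"
  shows "AE p in lborel. a p = 0"
proof (rule AE_eq_0_if_interval_integrals_0[OF a])
  fix \<alpha> \<beta> :: real assume "\<alpha> \<le> \<beta>"
  have [measurable]: "a \<in> borel_measurable borel" using a by auto
  \<comment> \<open>\<open>P\<close> is \<pi> times the Poisson kernel of the upper half-plane at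
    height \<eta>; \<open>Q\<close> is its integral over \<open>x\<close> between \<alpha> and
    \<beta>.\<close>
  define P where "P \<eta> x p = \<eta> / ((x - p)\<^sup>2 + \<eta>\<^sup>2)" for \<eta> x p :: real
  define Q where "Q \<eta> p = arctan ((\<beta> - p) / \<eta>) - arctan ((\<alpha> - p) / \<eta>)" for \<eta> p :: real
  have Poisson: "(\<integral>p. a p * of_real (P \<eta> x p) \<partial>lborel) = 0" if "\<eta> > 0" for \<eta> x
  proof -
    have int: "integrable lborel (\<lambda>p. a p / (Complex x \<theta> - of_real p))" if "\<bar>\<theta>\<bar> = \<eta>" for \<theta>
    proof (rule Bochner_Integration.integrable_bound[of _ "\<lambda>p. a p / of_real \<eta>"])
      have "norm (a p / (Complex x \<theta> - of_real p)) \<le> norm (a p / of_real \<eta>)" for p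
        using abs_Im_le_cmod[of "Complex x \<theta> - of_real p"] that \<open>\<eta> > 0\<close>
        by (auto simp: norm_divide intro!: divide_left_mono mult_pos_pos)
      then show "AE p in lborel. norm (a p / (Complex x \<theta> - of_real p)) \<le> norm (a p / of_real \<eta>)"
        by simp
    qed (use a in auto)
    \<comment> \<open>The Poisson kernel is the difference of the Cauchy kernels at the conjugate
      points x - i\<eta> and x + i\<eta>, and both Cauchy transforms vanish by assumption.\<close>
    have split: "a p * of_real (P \<eta> x p) =
        (a p / (Complex x (- \<eta>) - of_real p) - a p / (Complex x \<eta> - of_real p)) / (2 * \<i>)" for p
    proof -
      have ne: "Complex x (- \<eta>) - of_real p \<noteq> 0" "Complex x \<eta> - of_real p \<noteq> 0"
        using \<open>\<eta> > 0\<close> by (auto simp: complex_eq_iff)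
      have prod: "(Complex x (- \<eta>) - of_real p) * (Complex x \<eta> - of_real p) = of_real ((x - p)\<^sup>2 + \<eta>\<^sup>2)"
        by (simp add: complex_eq_iff power2_eq_square algebra_simps)
      have diff: "(Complex x \<eta> - of_real p) - (Complex x (- \<eta>) - of_real p) = of_real \<eta> * (2 * \<i>)"
        by (simp add: complex_eq_iff)
      have "a p / (Complex x (- \<eta>) - of_real p) - a p / (Complex x \<eta> - of_real p) =
          a p * ((Complex x \<eta> - of_real p) - (Complex x (- \<eta>) - of_real p)) / of_real ((x - p)\<^sup>2 + \<eta>\<^sup>2)"
        unfolding diff_frac_eq[OF ne] prod by (simp add: algebra_simps)
      also have "\<dots> = a p * of_real (P \<eta> x p) * (2 * \<i>)"
        unfolding diff P_def of_real_divide by simp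
      finally show ?thesis by (simp add: algebra_simps)
    qed
    show ?thesis
      unfolding split
      using zero[of "Complex x (- \<eta>)"] zero[of "Complex x \<eta>"] int[of \<eta>] int[of "- \<eta>"] \<open>\<eta> > 0\<close>
      by simp
  qed
  have Q_zero: "(\<integral>p. a p * of_real (Q \<eta> p) \<partial>lborel) = 0" if "\<eta> > 0" for \<eta>
  proof -
    have P_bound: "\<bar>P \<eta> x p\<bar> \<le> 1 / \<eta>" for x p
    proof -
      have "\<eta> / ((x - p)\<^sup>2 + \<eta>\<^sup>2) \<le> \<eta> / \<eta>\<^sup>2"
        using \<open>\<eta> > 0\<close> by (intro divide_left_mono mult_pos_pos) (auto simp: add_nonneg_pos)
      then show ?thesis
        using \<open>\<eta> > 0\<close> by (simp add: P_def power2_eq_square)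
    qed
    have inner: "(\<integral>x. a p * of_real (P \<eta> x p * indicator {\<alpha>..\<beta>} x) \<partial>lborel) = a p * of_real (Q \<eta> p)" for p
    proof -
      have "(\<integral>x. P \<eta> x p * indicator {\<alpha>..\<beta>} x \<partial>lborel) = Q \<eta> p"
        unfolding Q_def P_def
      proof (rule integral_FTC_Icc_real[OF \<open>\<alpha> \<le> \<beta>\<close>])
        fix x
        have nz: "(x - p)\<^sup>2 + \<eta>\<^sup>2 \<noteq> 0" "\<eta>\<^sup>2 + (x - p)\<^sup>2 \<noteq> 0" for x :: real
          using \<open>\<eta> > 0\<close> by (simp_all add: sum_power2_eq_zero_iff)
        have "inverse (1 + ((x - p) / \<eta>)\<^sup>2) * (1 / \<eta>) = \<eta> / ((x - p)\<^sup>2 + \<eta>\<^sup>2)"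
          using \<open>\<eta> > 0\<close> nz[of x] by (simp add: field_simps power2_eq_square)
        then show "((\<lambda>x. arctan ((x - p) / \<eta>)) has_real_derivative \<eta> / ((x - p)\<^sup>2 + \<eta>\<^sup>2)) (at x)"
          using \<open>\<eta> > 0\<close> by (auto intro!: derivative_eq_intros)
        show "isCont (\<lambda>x. \<eta> / ((x - p)\<^sup>2 + \<eta>\<^sup>2)) x"
          using nz by (auto intro!: continuous_intros)
      qed
      then show ?thesis
        by (simp only: integral_mult_right_zero integral_complex_of_real)
    qed
    have "(\<integral>p. a p * of_real (Q \<eta> p) \<partial>lborel) =
        (\<integral>p. (\<integral>x. a p * of_real (P \<eta> x p * indicator {\<alpha>..\<beta>} x) \<partial>lborel) \<partial>lborel)"
      by (simp only: inner)
    also have "\<dots> = (\<integral>x. (\<integral>p. a p * of_real (P \<eta> x p * indicator {\<alpha>..\<beta>} x) \<partial>lborel) \<partial>lborel)"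
    proof (rule Fubini_dominated[symmetric, OF a, where g = "\<lambda>x. (1 / \<eta>) * indicator {\<alpha>..\<beta>} x"])
      show "integrable lborel (\<lambda>x. (1 / \<eta>) * indicator {\<alpha>..\<beta>} x)"
        by (intro integrable_mult_right integrable_real_indicator) (use \<open>\<alpha> \<le> \<beta>\<close> in auto)
      show "(\<lambda>(p, x). a p * of_real (P \<eta> x p * indicator {\<alpha>..\<beta>} x)) \<in> borel_measurable (lborel \<Otimes>\<^sub>M lborel)"
        unfolding P_def by measurable
      show "cmod (a p * of_real (P \<eta> x p * indicator {\<alpha>..\<beta>} x)) \<le> cmod (a p) * ((1 / \<eta>) * indicator {\<alpha>..\<beta>} x)" for p x
        using mult_left_mono[OF P_bound[of x p], of "cmod (a p)"] by (auto simp: norm_mult indicator_def)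
    qed
    also have "\<dots> = (\<integral>x. (\<integral>p. (a p * of_real (P \<eta> x p)) \<partial>lborel) * of_real (indicator {\<alpha>..\<beta>} x) \<partial>lborel)"
      by (simp only: of_real_mult mult.assoc[symmetric] integral_mult_left_zero)
    also have "\<dots> = 0"
      using Poisson[OF \<open>\<eta> > 0\<close>] by simp
    finally show ?thesis .
  qed
  \<comment> \<open>The limit of \<open>Q\<close> as \<eta> tends to 0: \<pi> inside the interval
    and 0 outside. At the two endpoints it need not agree with \<pi> times the indicator, but they
    form a null set.\<close>
  define L where "L p = (pi / 2) * (sgn (\<beta> - p) - sgn (\<alpha> - p))" for p
  have "(\<lambda>n. \<integral>p. a p * of_real (Q (inverse (real (Suc n))) p) \<partial>lborel) \<longlonglongrightarrow> (\<integral>p. a p * of_real (L p) \<partial>lborel)"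
  proof (rule integral_dominated_convergence[where w = "\<lambda>p. pi * cmod (a p)"])
    have lim: "(\<lambda>n. arctan (y / inverse (real (Suc n)))) \<longlonglongrightarrow> (pi / 2) * sgn y" for y
    proof -
      have top: "filterlim (\<lambda>n. real (Suc n)) at_top sequentially"
        by (rule filterlim_compose[OF filterlim_real_sequentially filterlim_Suc])
      consider "y = 0" | "y > 0" | "y < 0" by linarith
      then show ?thesis
      proof cases
        case 2
        have "filterlim (\<lambda>n. y * real (Suc n)) at_top sequentially"
          by (rule filterlim_tendsto_pos_mult_at_top[OF tendsto_const 2 top])
        then have "(\<lambda>n. arctan (y * real (Suc n))) \<longlonglongrightarrow> (pi / 2)"
          by (rule filterlim_compose[OF tendsto_arctan_at_top])
        with 2 show ?thesis
          by (simp only: divide_inverse inverse_inverse_eq sgn_pos sgn_neg mult_1_right mult_minus_right)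
      next
        case 3
        have "filterlim (\<lambda>n. y * real (Suc n)) at_bot sequentially"
          by (rule filterlim_tendsto_neg_mult_at_bot[OF tendsto_const 3 top])
        then have "(\<lambda>n. arctan (y * real (Suc n))) \<longlonglongrightarrow> - (pi / 2)"
          by (rule filterlim_compose[OF tendsto_arctan_at_bot])
        with 3 show ?thesis
          by (simp only: divide_inverse inverse_inverse_eq sgn_pos sgn_neg mult_1_right mult_minus_right)
      qed simp
    qed
    show "AE p in lborel. (\<lambda>n. a p * of_real (Q (inverse (real (Suc n))) p)) \<longlonglongrightarrow> a p * of_real (L p)"
      unfolding Q_def L_def right_diff_distrib
      by (intro AE_I2 tendsto_mult tendsto_const tendsto_of_real tendsto_diff lim)
    show "AE p in lborel. norm (a p * of_real (Q (inverse (real (Suc n))) p)) \<le> pi * cmod (a p)" for n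
    proof (intro AE_I2)
      fix p
      have "\<bar>Q \<eta> p\<bar> \<le> pi" for \<eta>
        unfolding Q_def using arctan_bounded[of "(\<beta> - p) / \<eta>"] arctan_bounded[of "(\<alpha> - p) / \<eta>"] by linarith
      then show "norm (a p * of_real (Q (inverse (real (Suc n))) p)) \<le> pi * cmod (a p)"
        by (simp add: norm_mult mult.commute[of _ "cmod (a p)"] mult_left_mono)
    qed
  qed (use a in \<open>simp_all add: Q_def L_def\<close>)
  then have "(\<integral>p. a p * of_real (L p) \<partial>lborel) = 0"
    by (simp add: Q_zero LIMSEQ_const_iff)
  also have "(\<integral>p. a p * of_real (L p) \<partial>lborel) = (\<integral>p. of_real pi * (indicator {\<alpha>..\<beta>} p *\<^sub>R a p) \<partial>lborel)"
  proof (rule integral_cong_AE)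
    show "AE p in lborel. a p * of_real (L p) = of_real pi * (indicator {\<alpha>..\<beta>} p *\<^sub>R a p)"
      using AE_lborel_singleton[of \<alpha>] AE_lborel_singleton[of \<beta>]
      by eventually_elim (use \<open>\<alpha> \<le> \<beta>\<close> in \<open>auto simp: L_def sgn_if indicator_def\<close>)
  qed (simp_all add: L_def)
  finally show "(LINT p:{\<alpha>..\<beta>}|lborel. a p) = 0"
    unfolding set_lebesgue_integral_def integral_mult_right_zero by simp
qed

text \<open>The support condition makes the Cauchy transform \<open>S\<close> holomorphic off the
  nonnegative axis, and the decay makes the one-sided Laplace transform \<open>B\<close> holomorphic
  in a strip around that axis. They agree up to the factor i, so together they form a bounded entire
  function; Liouville and Stieltjes inversion finish.\<close>

lemma positive_frequency_exp_decay_imp_AE_0: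
  fixes a :: "real \<Rightarrow> complex" and C \<delta> :: real
  assumes a: "integrable lborel a" and supp: "\<And>p. p < 0 \<Longrightarrow> a p = 0"
    and "\<delta> > 0"
    and decay: "\<And>x. x > 0 \<Longrightarrow> cmod (\<integral>p. a p * exp (- \<i> * of_real (p * x)) \<partial>lborel) \<le> C * exp (- \<delta> * x)"
  shows "AE p in lborel. a p = 0"
proof -
  have [measurable]: "a \<in> borel_measurable borel" using a by auto
  define h where "h x = (\<integral>p. a p * exp (- \<i> * of_real (p * x)) \<partial>lborel)" for x
  have h_bound: "x > 0 \<Longrightarrow> cmod (h x) \<le> C * exp (- \<delta> * x)" for x
    unfolding h_def by (rule decay)
  have [measurable]: "h \<in> borel_measurable borel"
    unfolding h_def[abs_def] by measurable
  have "C \<ge> 0"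
    using order_trans[OF norm_ge_zero h_bound[of 1]] by (simp add: zero_le_mult_iff)
  define S where "S \<zeta> = (\<integral>p. a p / (\<zeta> - of_real p) \<partial>lborel)" for \<zeta>
  define B where "B \<zeta> = (\<integral>x. (indicator {0<..} x *\<^sub>R h x) * exp (\<i> * \<zeta> * of_real x) \<partial>lborel)" for \<zeta>

  have Im_bound: "cmod (a p / (\<zeta> - of_real p)) \<le> cmod (a p) / \<epsilon>" if "\<epsilon> > 0" "\<epsilon> \<le> \<bar>Im \<zeta>\<bar>" for \<zeta> \<epsilon> p
  proof -
    have "\<epsilon> \<le> cmod (\<zeta> - of_real p)"
      using abs_Im_le_cmod[of "\<zeta> - of_real p"] that by simp
    then show ?thesis
      using that by (auto simp: norm_divide intro!: divide_left_mono mult_pos_pos)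
  qed
  have S_bound: "cmod (S \<zeta>) \<le> (\<integral>p. cmod (a p) \<partial>lborel) / \<epsilon>" if "\<epsilon> > 0" "\<epsilon> \<le> \<bar>Im \<zeta>\<bar>" for \<zeta> \<epsilon>
  proof -
    have "cmod (S \<zeta>) \<le> (\<integral>p. cmod (a p / (\<zeta> - of_real p)) \<partial>lborel)"
      unfolding S_def by (rule integral_norm_bound)
    also have "\<dots> \<le> (\<integral>p. cmod (a p) / \<epsilon> \<partial>lborel)"
    proof (rule integral_mono)
      show "integrable lborel (\<lambda>p. cmod (a p / (\<zeta> - of_real p)))"
        by (rule Bochner_Integration.integrable_bound[of _ "\<lambda>p. cmod (a p) / \<epsilon>"])
           (use a that Im_bound in auto)
    qed (use a Im_bound[OF that] in auto)
    finally show ?thesis by simp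
  qed
  have S_holo: "S holomorphic_on - \<real>\<^sub>\<ge>\<^sub>0"
    unfolding holomorphic_on_def
  proof (intro ballI)
    fix z assume "z \<in> - (\<real>\<^sub>\<ge>\<^sub>0 :: complex set)"
    moreover have "open (- (\<real>\<^sub>\<ge>\<^sub>0 :: complex set))"
      by (simp add: open_Compl)
    ultimately obtain r0 where r0: "r0 > 0" "ball z r0 \<subseteq> - \<real>\<^sub>\<ge>\<^sub>0"
      by (auto simp: open_contains_ball)
    \<comment> \<open>Halving the radius keeps the small ball at distance at least \<open>r\<close>
      from every p \<ge> 0, uniformly; for p < 0 the integrand is 0 by \<open>supp\<close>.\<close>
    define r where "r = r0 / 2"
    have "r > 0" using r0 by (simp add: r_def)
    have far: "r \<le> cmod (\<zeta> - of_real p)" if "\<zeta> \<in> ball z r" "p \<ge> 0" for \<zeta> p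
    proof -
      have "of_real p \<notin> ball z r0" using r0 that by auto
      then have "2 * r \<le> dist z (of_real p)" by (simp add: r_def)
      also have "\<dots> \<le> dist z \<zeta> + dist \<zeta> (of_real p)" by (rule dist_triangle)
      finally show ?thesis using that by (simp add: dist_norm)
    qed
    have "((\<lambda>\<zeta>. \<integral>p. a p / (\<zeta> - of_real p) \<partial>lborel) has_field_derivative
        (\<integral>p. - a p / (z - of_real p)\<^sup>2 \<partial>lborel)) (at z)"
    proof (rule has_field_derivative_lebesgue_integral[OF \<open>r > 0\<close>, where w = "\<lambda>p. cmod (a p) / r\<^sup>2"])
      have int_r: "integrable lborel (\<lambda>p. cmod (a p) / r)" using a by simp
      fix \<zeta> assume \<zeta>: "\<zeta> \<in> ball z r"
      have "cmod (a p / (\<zeta> - of_real p)) \<le> cmod (a p) / r" for p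
        using far[OF \<zeta>, of p] supp[of p] \<open>r > 0\<close>
        by (cases "p < 0") (auto simp: norm_divide intro!: divide_left_mono mult_pos_pos)
      then show "integrable lborel (\<lambda>p. a p / (\<zeta> - of_real p))"
        using \<open>r > 0\<close> by (intro Bochner_Integration.integrable_bound[OF int_r]) auto
      fix p :: real
      show "((\<lambda>\<zeta>. a p / (\<zeta> - of_real p)) has_field_derivative - a p / (\<zeta> - of_real p)\<^sup>2) (at \<zeta>)"
      proof (cases "p < 0")
        case False
        then have "\<zeta> - of_real p \<noteq> 0" using far[OF \<zeta>, of p] \<open>r > 0\<close> by auto
        then show ?thesis
          by (auto intro!: derivative_eq_intros simp: power2_eq_square)
      qed (simp add: supp)
      show "cmod (- a p / (\<zeta> - of_real p)\<^sup>2) \<le> cmod (a p) / r\<^sup>2"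
        using far[OF \<zeta>, of p] supp[of p] \<open>r > 0\<close>
        by (cases "p < 0") (auto simp: norm_divide norm_power intro!: divide_left_mono mult_pos_pos power_mono zero_less_power)
    qed (use a in auto)
    then show "S field_differentiable at z within - \<real>\<^sub>\<ge>\<^sub>0"
      unfolding S_def[abs_def] field_differentiable_def
      by (auto intro: has_field_derivative_at_within)
  qed

  have strip_eq: "{\<zeta>. \<bar>Im \<zeta>\<bar> < \<delta>} = {\<zeta>. Im \<zeta> < \<delta>} \<inter> {\<zeta>. Im \<zeta> > - \<delta>}"
    by auto
  have open_strip: "open {\<zeta>. \<bar>Im \<zeta>\<bar> < \<delta>}" and convex_strip: "convex {\<zeta>. \<bar>Im \<zeta>\<bar> < \<delta>}"
    unfolding strip_eq
    by (intro open_Int convex_Int open_halfspace_Im_gt open_halfspace_Im_lt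
        convex_halfspace_Im_gt convex_halfspace_Im_lt)+
  have m_bound: "cmod (indicator {0<..} x *\<^sub>R h x) \<le> C * exp (- \<delta> * \<bar>x\<bar>)" for x
    using h_bound[of x] \<open>C \<ge> 0\<close> by (auto simp: indicator_def)
  have B_holo: "B holomorphic_on {\<zeta>. \<bar>Im \<zeta>\<bar> < \<delta>}"
    unfolding B_def[abs_def] by (rule holomorphic_on_Fourier_Laplace[OF _ m_bound]) simp
  \<comment> \<open>The bound on \<open>B\<close> blows up at the edge of the strip, so it is used
    only on the half-width strip; beyond that, \<open>S_bound\<close> takes over.\<close>
  define J where "J = C * (\<integral>v. exp (- (\<delta> / 2) * \<bar>v\<bar>) \<partial>lborel)"
  have B_bound: "cmod (B \<zeta>) \<le> J" if "\<bar>Im \<zeta>\<bar> \<le> \<delta> / 2" for \<zeta>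
    unfolding B_def J_def using that \<open>\<delta> > 0\<close> by (intro norm_Fourier_Laplace_le[OF _ m_bound]) auto

  \<comment> \<open>For Im \<zeta> > 0 the factor \<open>exp (\<i> * \<zeta> * x)\<close> decays, so
    Fubini is allowed, and the inner integral over x > 0 of e^(-i(p - \<zeta>)x) equals i / (\<zeta>
    - p).\<close>
  have B_eq_S_upper: "B \<zeta> = \<i> * S \<zeta>" if "Im \<zeta> > 0" for \<zeta>
  proof -
    have inner: "(\<integral>x. a p * (indicator {0<..} x *\<^sub>R exp (- (\<i> * (of_real p - \<zeta>)) * of_real x)) \<partial>lborel)
        = \<i> * (a p / (\<zeta> - of_real p))" for p
    proof -
      have ne: "\<zeta> - of_real p \<noteq> 0" using that by (auto simp: complex_eq_iff)
      have "(\<integral>x. indicator {0<..} x *\<^sub>R exp (- (\<i> * (of_real p - \<zeta>)) * of_real x) \<partial>lborel) = 1 / (\<i> * (of_real p - \<zeta>))"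
        using integral_exp_half_line[of "\<i> * (of_real p - \<zeta>)"] that by (simp add: set_lebesgue_integral_def)
      also have "\<dots> = \<i> / (\<zeta> - of_real p)"
        using ne by (simp add: divide_simps)
      finally have eq: "(\<integral>x. indicator {0<..} x *\<^sub>R exp (- (\<i> * (of_real p - \<zeta>)) * of_real x) \<partial>lborel) = \<i> / (\<zeta> - of_real p)" .
      show ?thesis unfolding integral_mult_right_zero eq by simp
    qed
    have "B \<zeta> = (\<integral>x. (\<integral>p. a p * (indicator {0<..} x *\<^sub>R exp (- (\<i> * (of_real p - \<zeta>)) * of_real x)) \<partial>lborel) \<partial>lborel)"
      unfolding B_def
    proof (intro Bochner_Integration.integral_cong refl)
      fix x :: real
      have "(indicator {0<..} x *\<^sub>R h x) * exp (\<i> * \<zeta> * of_real x) =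
          (\<integral>p. (a p * exp (- \<i> * of_real (p * x))) * (indicator {0<..} x *\<^sub>R exp (\<i> * \<zeta> * of_real x)) \<partial>lborel)"
        unfolding h_def by (subst integral_mult_left_zero) simp
      also have "\<dots> = (\<integral>p. a p * (indicator {0<..} x *\<^sub>R exp (- (\<i> * (of_real p - \<zeta>)) * of_real x)) \<partial>lborel)"
        by (intro Bochner_Integration.integral_cong refl)
           (simp add: exp_diff exp_minus algebra_simps field_simps)
      finally show "(indicator {0<..} x *\<^sub>R h x) * exp (\<i> * \<zeta> * of_real x) = \<dots>" .
    qed
    also have "\<dots> = (\<integral>p. (\<integral>x. a p * (indicator {0<..} x *\<^sub>R exp (- (\<i> * (of_real p - \<zeta>)) * of_real x)) \<partial>lborel) \<partial>lborel)"
    proof (rule Fubini_dominated[OF a, where g = "\<lambda>x. indicator {0<..} x *\<^sub>R exp (- Im \<zeta> * x)"])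
      show "integrable lborel (\<lambda>x. indicator {0<..} x *\<^sub>R exp (- Im \<zeta> * x))"
        using set_integrable_exp_neg[OF that] by (simp add: set_integrable_def)
    qed (auto simp: norm_mult)
    also have "\<dots> = (\<integral>p. \<i> * (a p / (\<zeta> - of_real p)) \<partial>lborel)"
      by (simp only: inner)
    also have "\<dots> = \<i> * S \<zeta>"
      unfolding S_def by (rule integral_mult_right_zero)
    finally show ?thesis .
  qed

  \<comment> \<open>The strip cut along the nonnegative axis is starlike about -1, hence connected.
    The upper and lower sides of the cut are joined through the negative axis, so the identity
    theorem carries \<open>B_eq_S_upper\<close> to the lower half as well.\<close>
  define W where "W = {\<zeta>. \<bar>Im \<zeta>\<bar> < \<delta>} \<inter> - (\<real>\<^sub>\<ge>\<^sub>0 :: complex set)"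
  have "open W"
    unfolding W_def by (intro open_Int open_strip) (simp add: open_Compl)
  have "starlike W"
    unfolding starlike_def
  proof (intro bexI ballI subsetI)
    show "-1 \<in> W" using \<open>\<delta> > 0\<close> by (auto simp: W_def complex_nonneg_Reals_iff)
    fix z w assume z: "z \<in> W" and w: "w \<in> closed_segment (-1) z"
    then obtain u where u: "0 \<le> u" "u \<le> 1" "w = (1 - u) *\<^sub>R (-1) + u *\<^sub>R z"
      by (auto simp: closed_segment_def)
    have "w \<in> {\<zeta>. \<bar>Im \<zeta>\<bar> < \<delta>}"
      using closed_segment_subset[OF _ _ convex_strip, of "-1" z] z w \<open>\<delta> > 0\<close> by (auto simp: W_def)
    moreover have "w \<notin> \<real>\<^sub>\<ge>\<^sub>0"
    proof
      assume "w \<in> \<real>\<^sub>\<ge>\<^sub>0"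
      then have uz: "u * Re z \<ge> 1 - u" "u * Im z = 0" using u by (auto simp: complex_nonneg_Reals_iff)
      then have "u > 0" using u by (cases "u = 0") auto
      moreover have "0 \<le> u * Re z" using uz(1) u(2) by linarith
      ultimately have "Re z \<ge> 0" "Im z = 0"
        using uz(2) by (auto simp: zero_le_mult_iff)
      then show False using z by (auto simp: W_def complex_nonneg_Reals_iff)
    qed
    ultimately show "w \<in> W" by (simp add: W_def)
  qed
  then have "connected W" by (rule starlike_imp_connected)
  have B_eq_S: "B \<zeta> = \<i> * S \<zeta>" if "\<zeta> \<in> W" for \<zeta>
  proof (rule analytic_continuation_open[of "{\<zeta>. Im \<zeta> > 0} \<inter> W" W B "\<lambda>\<zeta>. \<i> * S \<zeta>"])
    show "open ({\<zeta>. Im \<zeta> > 0} \<inter> W)" using \<open>open W\<close> by (intro open_Int open_halfspace_Im_gt)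
    have "\<i> * of_real (\<delta> / 2) \<in> {\<zeta>. Im \<zeta> > 0} \<inter> W"
      using \<open>\<delta> > 0\<close> by (auto simp: W_def complex_nonneg_Reals_iff)
    then show "{\<zeta>. Im \<zeta> > 0} \<inter> W \<noteq> {}" by blast
    show "B holomorphic_on W"
      by (rule holomorphic_on_subset[OF B_holo]) (auto simp: W_def)
    show "(\<lambda>\<zeta>. \<i> * S \<zeta>) holomorphic_on W"
      by (intro holomorphic_intros holomorphic_on_subset[OF S_holo]) (auto simp: W_def)
  qed (use \<open>open W\<close> \<open>connected W\<close> that B_eq_S_upper in auto)

  \<comment> \<open>The glued function is entire: the strip and the slit plane are open, cover the
    plane, and the two formulas agree on their overlap \<open>W\<close>.\<close>
  define E where "E \<zeta> = (if \<bar>Im \<zeta>\<bar> < \<delta> then B \<zeta> else \<i> * S \<zeta>)" for \<zeta>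
  have E_S: "E \<zeta> = \<i> * S \<zeta>" if "\<zeta> \<notin> \<real>\<^sub>\<ge>\<^sub>0" for \<zeta>
    using that B_eq_S[of \<zeta>] by (auto simp: E_def W_def)
  have "E holomorphic_on {\<zeta>. \<bar>Im \<zeta>\<bar> < \<delta>} \<union> - \<real>\<^sub>\<ge>\<^sub>0"
  proof (rule holomorphic_on_Un)
    show "E holomorphic_on {\<zeta>. \<bar>Im \<zeta>\<bar> < \<delta>}"
      using B_holo by (rule holomorphic_transform) (auto simp: E_def)
    have "(\<lambda>\<zeta>. \<i> * S \<zeta>) holomorphic_on - \<real>\<^sub>\<ge>\<^sub>0"
      by (intro holomorphic_intros S_holo)
    then show "E holomorphic_on - \<real>\<^sub>\<ge>\<^sub>0"
      by (rule holomorphic_transform) (simp add: E_S)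
  qed (use open_strip in \<open>simp_all add: open_Compl\<close>)
  moreover have "{\<zeta>. \<bar>Im \<zeta>\<bar> < \<delta>} \<union> - (\<real>\<^sub>\<ge>\<^sub>0 :: complex set) = UNIV"
    using \<open>\<delta> > 0\<close> by (auto simp: complex_nonneg_Reals_iff)
  ultimately have E_holo: "E holomorphic_on UNIV" by simp
  define A where "A = (\<integral>p. cmod (a p) \<partial>lborel)"
  have E_bound: "cmod (E \<zeta>) \<le> A / \<epsilon>" if "\<epsilon> > 0" "\<epsilon> \<le> \<bar>Im \<zeta>\<bar>" for \<zeta> \<epsilon>
  proof -
    have "\<zeta> \<notin> \<real>\<^sub>\<ge>\<^sub>0" using that by (auto simp: complex_nonneg_Reals_iff)
    then show ?thesis using S_bound[OF that] by (simp add: E_S A_def norm_mult)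
  qed
  have "cmod (E \<zeta>) \<le> max J (A / (\<delta> / 2))" for \<zeta>
  proof (cases "\<bar>Im \<zeta>\<bar> \<le> \<delta> / 2")
    case True
    then have "E \<zeta> = B \<zeta>" using \<open>\<delta> > 0\<close> by (simp add: E_def)
    then show ?thesis using B_bound[OF True] by (simp add: le_max_iff_disj)
  next
    case False
    then show ?thesis using E_bound[of "\<delta> / 2" \<zeta>] \<open>\<delta> > 0\<close> by (simp add: le_max_iff_disj)
  qed
  then have "bounded (range E)" by (auto simp: bounded_iff)
  then obtain c where c: "\<And>\<zeta>. E \<zeta> = c"
    using Liouville_theorem[OF E_holo] by (auto simp: constant_on_def)
  have "A \<ge> 0" by (simp add: A_def)
  have "cmod c \<le> 0"
  proof (rule field_le_epsilon)
    fix e :: real assume "e > 0"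
    \<comment> \<open>A point high on the imaginary axis, where the bound A / Im \<zeta> drops below
      \<open>e\<close>; A + 1 in place of A keeps \<open>y\<close> positive even if A = 0.\<close>
    define y where "y = (A + 1) / e"
    have "y > 0" using \<open>e > 0\<close> \<open>A \<ge> 0\<close> by (simp add: y_def)
    then have "cmod c \<le> A / y" using E_bound[of y "\<i> * of_real y"] c by simp
    also have "A / y \<le> e" using \<open>e > 0\<close> \<open>A \<ge> 0\<close> by (simp add: y_def field_simps)
    finally show "cmod c \<le> 0 + e" by simp
  qed
  then have "S \<zeta> = 0" if "\<zeta> \<notin> \<real>\<^sub>\<ge>\<^sub>0" for \<zeta>
    using E_S[OF that] c[of \<zeta>] by simp
  then show ?thesis
    by (intro AE_eq_0_if_Cauchy_transform_0[OF a]) (auto simp: S_def complex_nonneg_Reals_iff)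
qed

subsection \<open>The test function and its convolution kernel\<close>

text \<open>The derivative of s k e^(-sk) in k, hence of mean 0 on the half-line. The vanishing mean
  makes its Fourier integral vanish at frequency 0, which is what makes \<open>mellin_kernel\<close>
  decay at +\<infinity>.\<close>

definition smoothing :: "real \<Rightarrow> real \<Rightarrow> real" where
  "smoothing s k = s * exp (- s * k) * (1 - s * k)"

text \<open>The Fourier integral of \<open>smoothing s\<close> at frequency t, which depends on t /
  s only, written in the logarithmic variable t / s = e^(-v); see
  \<open>integral_smoothing_exp\<close>.\<close>

definition mellin_kernel :: "real \<Rightarrow> complex" where
  "mellin_kernel v = - \<i> * exp (- of_real v) / (1 - \<i> * exp (- of_real v))\<^sup>2"

lemma borel_measurable_smoothing [measurable]: "smoothing s \<in> borel_measurable borel"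
  unfolding smoothing_def[abs_def] by measurable

lemma borel_measurable_kernel [measurable]: "mellin_kernel \<in> borel_measurable borel"
  unfolding mellin_kernel_def[abs_def] by measurable

lemma one_minus_ii_exp_nonzero: "1 - \<i> * exp (- complex_of_real v) \<noteq> 0"
  by (auto simp: complex_eq_iff exp_of_real simp flip: of_real_minus)

text \<open>With e = e^(-v) the modulus is exactly e / (1 + e^2); dropping one or the other summand
  of the denominator gives the decay on each side.\<close>

lemma norm_kernel_le: "cmod (mellin_kernel v) \<le> exp (- \<bar>v\<bar>)"
proof -
  define e where "e = exp (- v)"
  have e: "e > 0" by (simp add: e_def)
  have "(cmod (1 - \<i> * of_real e))\<^sup>2 = 1 + e\<^sup>2"
    by (simp add: cmod_power2)
  moreover have "cmod (mellin_kernel v) = e / (cmod (1 - \<i> * of_real e))\<^sup>2"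
    using e by (simp add: mellin_kernel_def e_def norm_divide norm_mult norm_power exp_of_real flip: of_real_minus)
  ultimately have norm_eq: "cmod (mellin_kernel v) = e / (1 + e\<^sup>2)" by simp
  show ?thesis
  proof (cases "v \<ge> 0")
    case True
    have "e / (1 + e\<^sup>2) \<le> e / 1"
      using e by (intro divide_left_mono) (auto simp: add_pos_nonneg)
    then show ?thesis using True by (simp add: norm_eq e_def)
  next
    case False
    have "e / (1 + e\<^sup>2) \<le> e / e\<^sup>2"
      using e by (intro divide_left_mono mult_pos_pos) (auto simp: add_pos_nonneg)
    also have "e / e\<^sup>2 = exp v"
      using e by (simp add: power2_eq_square) (simp add: e_def exp_minus inverse_eq_divide)
    finally show ?thesis using False by (simp add: norm_eq)
  qed
qed

lemma norm_kernel_le': "cmod (mellin_kernel v) \<le> 1 * exp (- 1 * \<bar>v\<bar>)"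
  using norm_kernel_le[of v] by simp

lemma integrable_kernel: "integrable lborel mellin_kernel"
  using integrable_Fourier_Laplace[OF borel_measurable_kernel norm_kernel_le', of 0] by simp

text \<open>The antiderivative 1 / (1 - i e^(-v)) runs from 0 at -\<infinity> to 1 at +\<infinity>.
  Its purpose is to show that the Fourier transform of the kernel does not vanish at 0.\<close>

lemma integral_kernel: "(\<integral>v. mellin_kernel v \<partial>lborel) = 1"
proof -
  define F where "F v = 1 / (1 - \<i> * exp (- complex_of_real v))" for v
  have "(LBINT v=-\<infinity>..\<infinity>. mellin_kernel v) = 1 - 0"
  proof (rule interval_integral_FTC_integrable[where F = F])
    show "(F has_vector_derivative mellin_kernel v) (at v)" for v
    proof -
      have "((\<lambda>z. 1 / (1 - \<i> * exp (- z))) has_field_derivative mellin_kernel v) (at (complex_of_real v))"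
        using one_minus_ii_exp_nonzero[of v]
        by (auto intro!: derivative_eq_intros simp: mellin_kernel_def power2_eq_square)
      then show ?thesis
        unfolding F_def[abs_def] by (rule has_vector_derivative_real_field)
    qed
    show "isCont mellin_kernel v" for v
      unfolding mellin_kernel_def[abs_def] using one_minus_ii_exp_nonzero
      by (intro continuous_intros) auto
    show "set_integrable lborel (einterval (-\<infinity>) \<infinity>) mellin_kernel"
      using integrable_kernel by (simp add: set_integrable_def)
    have "((\<lambda>v. exp (- v)) \<longlongrightarrow> (0::real)) at_top" by real_asymp
    then have "((\<lambda>v. complex_of_real (exp (- v))) \<longlongrightarrow> of_real 0) at_top"
      by (rule tendsto_of_real)
    then have "(F \<longlongrightarrow> 1 / (1 - \<i> * of_real 0)) at_top"
      unfolding F_def[abs_def] by (intro tendsto_intros) (simp_all flip: exp_of_real)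
    then show "((F \<circ> real_of_ereal) \<longlongrightarrow> 1) (at_left \<infinity>)"
      unfolding ereal_tendsto_simps1 by simp
    have "((\<lambda>v. exp v) \<longlongrightarrow> (0::real)) at_bot" by (rule exp_at_bot)
    then have "((\<lambda>v. cmod (F v)) \<longlongrightarrow> 0) at_bot"
    proof (rule Lim_null_comparison[rotated])
      show "\<forall>\<^sub>F v in at_bot. norm (cmod (F v)) \<le> exp v"
      proof (intro always_eventually allI)
        fix v :: real
        have "exp (- v) \<le> cmod (1 - \<i> * exp (- complex_of_real v))"
          using abs_Im_le_cmod[of "1 - \<i> * exp (- complex_of_real v)"]
          by (simp add: exp_of_real flip: of_real_minus)
        then have "1 / cmod (1 - \<i> * exp (- complex_of_real v)) \<le> 1 / exp (- v)"
          by (intro divide_left_mono mult_pos_pos) (use one_minus_ii_exp_nonzero[of v] in auto)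
        then show "norm (cmod (F v)) \<le> exp v"
          by (simp add: F_def norm_divide exp_minus inverse_eq_divide)
      qed
    qed
    then show "((F \<circ> real_of_ereal) \<longlongrightarrow> 0) (at_right (-\<infinity>))"
      unfolding ereal_tendsto_simps1 by (rule tendsto_norm_zero_cancel)
  qed simp
  then show ?thesis
    by (simp add: interval_lebesgue_integral_def set_lebesgue_integral_def)
qed

lemma norm_smoothing_le:
  assumes "s > 0" "k > 0"
  shows "\<bar>smoothing s k\<bar> \<le> 2 * s * exp (- (s / 2) * k)"
proof -
  have "s * k > 0" using assms by simp
  then have "\<bar>1 - s * k\<bar> \<le> 2 * exp (s * k / 2)"
    unfolding abs_le_iff using exp_ge_add_one_self[of "s * k / 2"] by linarith
  then have "\<bar>smoothing s k\<bar> \<le> s * exp (- s * k) * (2 * exp (s * k / 2))"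
    using assms unfolding smoothing_def abs_mult by (intro mult_mono) auto
  also have "\<dots> = 2 * s * exp (- s * k + s * k / 2)"
    unfolding exp_add by (simp only: mult_ac)
  also have "- s * k + s * k / 2 = - (s / 2) * k" by simp
  finally show ?thesis .
qed

text \<open>A bound uniform in the scale \<open>s\<close>. The factor k^2 is what the reciprocal
  thermal weight supplies near k = 0 in the AM-GM estimate.\<close>

lemma smoothing_square_le:
  assumes "s > 0" "k > 0"
  shows "(k * smoothing s k)\<^sup>2 \<le> 64 * exp (- s * k)"
proof -
  define j where "j = s * k"
  have "j > 0" using assms by (simp add: j_def)
  have "\<bar>k * smoothing s k\<bar> = j * \<bar>1 - j\<bar> * exp (- j)"
    using assms by (simp add: smoothing_def j_def abs_mult)
  also have "\<dots> \<le> 8 * exp (j / 2) * exp (- j)"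
  proof (rule mult_right_mono)
    have "j * \<bar>1 - j\<bar> \<le> j + j\<^sup>2"
      using \<open>j > 0\<close> by (auto simp: abs_if power2_eq_square algebra_simps)
    \<comment> \<open>The quadratic Taylor term of e^(j/2) is j^2 / 8, whence the constant
      8.\<close>
    also have "\<dots> \<le> 8 * exp (j / 2)"
      using exp_lower_Taylor_quadratic[of "j / 2"] \<open>j > 0\<close> by (simp add: power2_eq_square field_simps)
    finally show "j * \<bar>1 - j\<bar> \<le> 8 * exp (j / 2)" .
  qed simp
  also have "\<dots> = 8 * exp (- j / 2)"
    by (simp add: mult.assoc flip: exp_add)
  finally have "\<bar>k * smoothing s k\<bar>\<^sup>2 \<le> (8 * exp (- j / 2))\<^sup>2"
    by (intro power_mono) auto
  also have "\<dots> = 64 * exp (- s * k)"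
    by (simp add: power_mult_distrib j_def flip: exp_double)
  finally show ?thesis by simp
qed

lemma integral_smoothing_exp:
  assumes "s > 0"
  shows "(LINT k:{0<..}|lborel. of_real (smoothing s k) * exp (\<i> * of_real (k * t))) =
    - \<i> * of_real (t / s) / (1 - \<i> * of_real (t / s))\<^sup>2"
proof -
  define w where "w = of_real s - \<i> * of_real t"
  have Re_w: "Re w > 0" using assms by (simp add: w_def)
  then have "w \<noteq> 0" by auto
  \<comment> \<open>An explicit antiderivative of s (1 - s z) e^(-wz): matching the coefficient of z
    fixes the linear term, and it = s - w then fixes the constant one.\<close>
  define F where "F z = exp (- w * z) * (\<i> * of_real (s * t) / w\<^sup>2 + of_real (s\<^sup>2) / w * z)" for z
  have "(LINT k:{0<..}|lborel. of_real (smoothing s k) * exp (\<i> * of_real (k * t))) = - F (of_real 0)"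
  proof (rule integral_half_line_FTC[where F = "\<lambda>x. F (of_real x)"])
    fix x :: real
    have eq: "of_real (smoothing s x) * exp (\<i> * of_real (x * t)) =
        exp (- w * of_real x) * (of_real s * (1 - of_real s * of_real x))"
    proof -
      have "exp (- w * of_real x) = exp (- (of_real (s * x))) * exp (\<i> * of_real (x * t))"
        by (simp add: w_def algebra_simps flip: exp_add)
      then show ?thesis by (simp add: smoothing_def exp_of_real[symmetric])
    qed
    have der_exp: "((\<lambda>z. exp (- w * z)) has_field_derivative exp (- w * of_real x) * - w) (at (of_real x))"
      by (auto intro!: derivative_eq_intros)
    have der_lin: "((\<lambda>z. \<alpha> + \<gamma> * z) has_field_derivative \<gamma>) (at (of_real x))" for \<alpha> \<gamma> :: complex
      by (auto intro!: derivative_eq_intros)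
    have w_eq: "\<i> * of_real t = of_real s - w" by (simp add: w_def)
    have "(F has_field_derivative exp (- w * of_real x) * (of_real s * (1 - of_real s * of_real x))) (at (of_real x))"
      unfolding F_def[abs_def]
    proof (rule DERIV_cong[OF DERIV_mult[OF der_exp der_lin]])
      have "- w * (\<i> * of_real (s * t) / w\<^sup>2 + of_real (s\<^sup>2) / w * of_real x) + of_real (s\<^sup>2) / w
          = of_real s * (of_real s - \<i> * of_real t) / w - of_real s * of_real s * of_real x"
        using \<open>w \<noteq> 0\<close> by (simp add: field_simps power2_eq_square)
      also have "\<dots> = of_real s * (1 - of_real s * of_real x)"
        unfolding w_eq using \<open>w \<noteq> 0\<close> by (simp add: algebra_simps)
      finally have eq: "- w * (\<i> * of_real (s * t) / w\<^sup>2 + of_real (s\<^sup>2) / w * of_real x) + of_real (s\<^sup>2) / w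
          = of_real s * (1 - of_real s * of_real x)" .
      show "exp (- w * of_real x) * - w * (\<i> * of_real (s * t) / w\<^sup>2 + of_real (s\<^sup>2) / w * of_real x) +
          of_real (s\<^sup>2) / w * exp (- w * of_real x) = exp (- w * of_real x) * (of_real s * (1 - of_real s * of_real x))"
        unfolding eq[symmetric] by (simp only: distrib_left mult_ac)
    qed
    then show "((\<lambda>x. F (of_real x)) has_vector_derivative of_real (smoothing s x) * exp (\<i> * of_real (x * t))) (at x)"
      unfolding eq by (rule has_vector_derivative_real_field)
  next
    show "continuous_on UNIV (\<lambda>x. complex_of_real (smoothing s x) * exp (\<i> * of_real (x * t)))"
      unfolding smoothing_def by (intro continuous_intros)
    have int: "integrable lborel (\<lambda>k. 2 * s * (indicator {0<..} k *\<^sub>R exp (- (s / 2) * k)))"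
      using set_integrable_exp_neg[of "s / 2"] assms unfolding set_integrable_def by (intro integrable_mult_right) auto
    show "set_integrable lborel {0<..} (\<lambda>k. of_real (smoothing s k) * exp (\<i> * of_real (k * t)))"
      unfolding set_integrable_def
      using norm_smoothing_le[OF assms] assms
      by (intro Bochner_Integration.integrable_bound[OF int]) (auto simp: indicator_def norm_mult abs_mult)
    have "((\<lambda>x. \<i> * of_real (s * t) / w\<^sup>2 * exp (- w * of_real x) +
        of_real (s\<^sup>2) / w * (of_real x * exp (- w * of_real x))) \<longlongrightarrow>
        \<i> * of_real (s * t) / w\<^sup>2 * 0 + of_real (s\<^sup>2) / w * 0) at_top"
      by (intro tendsto_intros exp_complex_tendsto_0_at_top Re_w)
    then show "((\<lambda>x. F (of_real x)) \<longlongrightarrow> 0) at_top"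
      by (simp add: F_def algebra_simps)
  qed
  also have "\<dots> = - \<i> * of_real (s * t) / w\<^sup>2" by (simp add: F_def)
  also have "w = of_real s * (1 - \<i> * of_real (t / s))"
    using assms by (simp add: w_def algebra_simps)
  finally show ?thesis
    using assms by (simp add: power_mult_distrib power2_eq_square)
qed

subsection \<open>Black-hole transform\<close>

text \<open>The phase of the black-hole transform is e^(ik e^(-y)), so after Fubini the k-integral
  is a Fourier integral of the test function at t = e^(-y). At scale s = e^x it depends on t / s =
  e^(-(x + y)), so scaling in k becomes translation in y. Here \<open>x\<close> is the logarithm of
  the scale.\<close>

lemma integral_smoothing_U_transform:
  assumes int: "integrable lborel (position_wave ft)"
  shows "(LINT k:{0<..}|lborel. of_real (smoothing (exp x) k) * U_transform black_hole_x ft k) =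
    of_real (1 / sqrt (2 * pi)) * (\<integral>y. position_wave ft y * mellin_kernel (x + y) \<partial>lborel)"
proof -
  define c where "c = complex_of_real (1 / sqrt (2 * pi))"
  define \<phi> where "\<phi> = position_wave ft"
  have \<phi>: "integrable lborel \<phi>" using int by (simp add: \<phi>_def)
  then have [measurable]: "\<phi> \<in> borel_measurable borel" by auto
  define H where "H y k = \<phi> y * (indicator {0<..} k *\<^sub>R
      (of_real (smoothing (exp x) k) * exp (\<i> * of_real (k * exp (- y)))))" for y k
  have inner: "(\<integral>k. H y k \<partial>lborel) = \<phi> y * mellin_kernel (x + y)" for y
  proof -
    have "exp (- y) / exp x = exp (- (x + y))"
      by (simp add: exp_diff[symmetric] flip: exp_minus)
    then have "complex_of_real (exp (- y) / exp x) = exp (- of_real (x + y))"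
      by (simp only: exp_of_real[symmetric] of_real_minus)
    then show ?thesis
      unfolding H_def integral_mult_right_zero mellin_kernel_def
      using integral_smoothing_exp[of "exp x" "exp (- y)"]
      by (simp only: set_lebesgue_integral_def exp_gt_zero simp_thms)
  qed
  have "(LINT k:{0<..}|lborel. of_real (smoothing (exp x) k) * U_transform black_hole_x ft k) =
      (\<integral>k. c * (\<integral>y. H y k \<partial>lborel) \<partial>lborel)"
    unfolding set_lebesgue_integral_def
  proof (intro Bochner_Integration.integral_cong refl)
    fix k :: real
    have "(\<integral>y. H y k \<partial>lborel) = (\<integral>y. (indicator {0<..} k *\<^sub>R of_real (smoothing (exp x) k)) *
        (exp (- \<i> * of_real (k * black_hole_x y)) * \<phi> y) \<partial>lborel)"
      by (intro Bochner_Integration.integral_cong refl) (simp add: H_def black_hole_x_def)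
    then show "indicator {0<..} k *\<^sub>R (of_real (smoothing (exp x) k) * U_transform black_hole_x ft k) =
        c * (\<integral>y. H y k \<partial>lborel)"
      unfolding U_transform_def c_def[symmetric] \<phi>_def[symmetric] integral_mult_right_zero
      by simp
  qed
  also have "\<dots> = c * (\<integral>k. (\<integral>y. H y k \<partial>lborel) \<partial>lborel)"
    by (rule integral_mult_right_zero)
  also have "(\<integral>k. (\<integral>y. H y k \<partial>lborel) \<partial>lborel) = (\<integral>y. (\<integral>k. H y k \<partial>lborel) \<partial>lborel)"
  proof (rule Fubini_dominated[OF \<phi>, where g = "\<lambda>k. 2 * exp x * (indicator {0<..} k *\<^sub>R exp (- (exp x / 2) * k))"])
    show "integrable lborel (\<lambda>k. 2 * exp x * (indicator {0<..} k *\<^sub>R exp (- (exp x / 2) * k)))"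
      using set_integrable_exp_neg[of "exp x / 2"] unfolding set_integrable_def
      by (intro integrable_mult_right) auto
    show "(\<lambda>(y, k). H y k) \<in> borel_measurable (lborel \<Otimes>\<^sub>M lborel)"
      unfolding H_def by measurable
    show "cmod (H y k) \<le> cmod (\<phi> y) * (2 * exp x * (indicator {0<..} k *\<^sub>R exp (- (exp x / 2) * k)))" for y k
      using norm_smoothing_le[of "exp x" k]
      by (auto simp: H_def norm_mult indicator_def intro!: mult_left_mono)
  qed
  finally show ?thesis by (simp only: inner c_def \<phi>_def)
qed

section \<open>Fourier transform of the kernel and the frequency representation\<close>

definition kernel_transform :: "complex \<Rightarrow> complex" where
  "kernel_transform z = (\<integral>v. mellin_kernel v * exp (\<i> * z * of_real v) \<partial>lborel)"

lemma kernel_transform_holomorphic: "kernel_transform holomorphic_on {z. \<bar>Im z\<bar> < 1}"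
  unfolding kernel_transform_def[abs_def]
  by (rule holomorphic_on_Fourier_Laplace[OF borel_measurable_kernel norm_kernel_le'])

lemma norm_kernel_transform_le: "cmod (kernel_transform (of_real p)) \<le> (\<integral>v. cmod (mellin_kernel v) \<partial>lborel)"
proof -
  have "cmod (kernel_transform (of_real p)) \<le> (\<integral>v. cmod (mellin_kernel v * exp (\<i> * of_real p * of_real v)) \<partial>lborel)"
    unfolding kernel_transform_def by (rule integral_norm_bound)
  then show ?thesis by (simp add: norm_mult)
qed

lemma borel_measurable_kernel_transform [measurable]:
  "(\<lambda>p::real. kernel_transform (of_real p)) \<in> borel_measurable borel"
  unfolding kernel_transform_def by measurable

text \<open>The transform is holomorphic on a connected strip and equals 1 at 0, so it has finitely
  many zeros on each compact interval. Hence its real zeros form a null set, and \<open>ft\<close>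
  can be recovered almost everywhere from its product with the transform.\<close>

lemma countable_zeros_kernel_transform: "countable {p::real. kernel_transform (of_real p) = 0}"
proof -
  define S where "S = {z. \<bar>Im z\<bar> < 1}"
  have S: "S = {z. Im z < 1} \<inter> {z. Im z > - 1}" by (auto simp: S_def)
  have "open S" "convex S"
    unfolding S by (intro open_Int convex_Int open_halfspace_Im_gt open_halfspace_Im_lt
        convex_halfspace_Im_gt convex_halfspace_Im_lt)+
  have one: "kernel_transform 0 = 1"
    using integral_kernel by (simp add: kernel_transform_def)
  have fin: "finite {p::real. p \<in> {- real n..real n} \<and> kernel_transform (of_real p) = 0}" for n
  proof (cases "kernel_transform constant_on S")
    \<comment> \<open>A constant transform would be constantly 1 and have no zeros at all; the
      theorem on zeros in compact sets covers only the nonconstant case.\<close>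
    case True
    then have "kernel_transform (of_real p) = kernel_transform 0" for p :: real
      unfolding constant_on_def S_def by fastforce
    then show ?thesis by (simp add: one)
  next
    case False
    have "finite {z \<in> complex_of_real ` {- real n..real n}. kernel_transform z = 0}"
      using kernel_transform_holomorphic \<open>open S\<close> convex_connected[OF \<open>convex S\<close>] False
      by (intro holomorphic_compact_finite_zeros[of _ S])
         (auto simp: S_def intro!: compact_continuous_image continuous_intros)
    then have "finite (complex_of_real -` {z \<in> complex_of_real ` {- real n..real n}. kernel_transform z = 0})"
      by (rule finite_vimageI) (simp add: inj_on_def)
    then show ?thesis by (rule rev_finite_subset) auto
  qed
  have "{p::real. kernel_transform (of_real p) = 0} =
      (\<Union>n. {p. p \<in> {- real n..real n} \<and> kernel_transform (of_real p) = 0})"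
  proof (intro set_eqI iffI)
    fix p :: real assume "p \<in> {p. kernel_transform (of_real p) = 0}"
    moreover obtain n where "\<bar>p\<bar> \<le> real n" using real_arch_simple by blast
    ultimately show "p \<in> (\<Union>n. {p. p \<in> {- real n..real n} \<and> kernel_transform (of_real p) = 0})"
      by (auto simp: abs_le_iff intro!: exI[of _ n])
  qed auto
  then show ?thesis using fin by (simp add: countable_finite)
qed

text \<open>After Fubini and the shift v = x + y, each frequency p of the wave contributes e^(-ipx)
  times the transform of the kernel at p. Only p > 0 occurs, which is the support condition of the
  uniqueness result.\<close>

lemma integral_position_wave_kernel:
  assumes ft: "set_integrable lborel {0<..} ft"
  shows "(\<integral>y. position_wave ft y * mellin_kernel (x + y) \<partial>lborel) = of_real (1 / sqrt (2 * pi)) *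
    (\<integral>p. (indicator {0<..} p *\<^sub>R ft p) * kernel_transform (of_real p) * exp (- \<i> * of_real (p * x)) \<partial>lborel)"
proof -
  define c where "c = complex_of_real (1 / sqrt (2 * pi))"
  define F where "F p = indicator {0<..} p *\<^sub>R ft p" for p
  have F: "integrable lborel F" using ft by (simp add: F_def[abs_def] set_integrable_def)
  then have [measurable]: "F \<in> borel_measurable borel" by auto
  define H where "H p y = F p * (exp (\<i> * of_real (p * y)) * mellin_kernel (x + y))" for p y
  have inner: "(\<integral>y. H p y \<partial>lborel) = F p * kernel_transform (of_real p) * exp (- \<i> * of_real (p * x))" for p
  proof -
    have "(\<integral>y. exp (\<i> * of_real (p * y)) * mellin_kernel (x + y) \<partial>lborel) =
        (\<integral>v. exp (\<i> * of_real (p * (- x + 1 * v))) * mellin_kernel (x + (- x + 1 * v)) \<partial>lborel)"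
      by (subst lborel_integral_real_affine[of 1 _ "- x"]) simp_all
    also have "\<dots> = (\<integral>v. exp (- \<i> * of_real (p * x)) * (mellin_kernel v * exp (\<i> * of_real p * of_real v)) \<partial>lborel)"
    proof (intro Bochner_Integration.integral_cong refl)
      fix v
      have "exp (\<i> * of_real (p * (- x + 1 * v))) = exp (- \<i> * of_real (p * x)) * exp (\<i> * of_real p * of_real v)"
        unfolding exp_add[symmetric] by (rule arg_cong[where f = exp]) (simp add: algebra_simps)
      then show "exp (\<i> * of_real (p * (- x + 1 * v))) * mellin_kernel (x + (- x + 1 * v)) =
          exp (- \<i> * of_real (p * x)) * (mellin_kernel v * exp (\<i> * of_real p * of_real v))"
        by simp
    qed
    also have "\<dots> = exp (- \<i> * of_real (p * x)) * kernel_transform (of_real p)"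
      unfolding kernel_transform_def by (rule integral_mult_right_zero)
    finally have eq: "(\<integral>y. exp (\<i> * of_real (p * y)) * mellin_kernel (x + y) \<partial>lborel) =
        exp (- \<i> * of_real (p * x)) * kernel_transform (of_real p)" .
    show ?thesis unfolding H_def integral_mult_right_zero eq by (simp only: mult_ac)
  qed
  have "(\<integral>y. position_wave ft y * mellin_kernel (x + y) \<partial>lborel) = (\<integral>y. c * (\<integral>p. H p y \<partial>lborel) \<partial>lborel)"
  proof (intro Bochner_Integration.integral_cong refl)
    fix y
    have "(\<integral>p. H p y \<partial>lborel) = (\<integral>p. (F p * exp (\<i> * of_real (p * y))) * mellin_kernel (x + y) \<partial>lborel)"
      by (simp add: H_def mult.assoc)
    also have "\<dots> = (\<integral>p. F p * exp (\<i> * of_real (p * y)) \<partial>lborel) * mellin_kernel (x + y)"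
      by (rule integral_mult_left_zero)
    finally show "position_wave ft y * mellin_kernel (x + y) = c * (\<integral>p. H p y \<partial>lborel)"
      by (simp add: position_wave_def set_lebesgue_integral_def F_def c_def)
  qed
  also have "\<dots> = c * (\<integral>y. (\<integral>p. H p y \<partial>lborel) \<partial>lborel)"
    by (rule integral_mult_right_zero)
  also have "(\<integral>y. (\<integral>p. H p y \<partial>lborel) \<partial>lborel) = (\<integral>p. (\<integral>y. H p y \<partial>lborel) \<partial>lborel)"
  \<comment> \<open>The majorant is written with the factors 1 to match the affine substitution rule
    and \<open>integrable_exp_neg_abs\<close>.\<close>
  proof (rule Fubini_dominated[OF F, where g = "\<lambda>y. exp (- 1 * \<bar>x + 1 * y\<bar>)"])
    show "integrable lborel (\<lambda>y. exp (- 1 * \<bar>x + 1 * y\<bar>))"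
      by (rule lborel_integrable_real_affine[OF integrable_exp_neg_abs]) simp_all
    show "(\<lambda>(p, y). H p y) \<in> borel_measurable (lborel \<Otimes>\<^sub>M lborel)"
      unfolding H_def by measurable
    show "cmod (H p y) \<le> cmod (F p) * exp (- 1 * \<bar>x + 1 * y\<bar>)" for p y
      using norm_kernel_le[of "x + y"] by (simp add: H_def norm_mult mult_left_mono)
  qed
  finally show ?thesis by (simp only: inner c_def F_def)
qed

section \<open>Decay forced by a finite thermal excess\<close>

lemma thermal_excess_finite_imp_integrable:
  assumes "\<beta> > 0" and [measurable]: "x \<in> borel_measurable borel"
    and int: "integrable lborel (position_wave ft)"
    and fin: "thermal_excess x \<beta> ft < \<infinity>"
  shows "set_integrable lborel {0<..} (\<lambda>k. (cmod (U_transform x ft k))\<^sup>2 / (2 * k * (exp (\<beta> * k) - 1)))"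
  unfolding set_integrable_def
proof (rule integrableI_bounded)
  define V where "V = U_transform x ft"
  have [measurable]: "V \<in> borel_measurable borel"
    unfolding V_def using assms(2,3) by (rule borel_measurable_U_transform)
  have "(\<integral>\<^sup>+k. ennreal (norm (indicator {0<..} k *\<^sub>R ((cmod (V k))\<^sup>2 / (2 * k * (exp (\<beta> * k) - 1))))) \<partial>lborel) \<le>
     (\<integral>\<^sup>+k. ennreal (1 / (2 * k)) * ennreal (1 / (exp (\<beta> * k) - 1) * ((cmod (V k))\<^sup>2 + (cmod (V (- k)))\<^sup>2))
        * indicator {0<..} k \<partial>lborel)"
  proof (intro nn_integral_mono)
    fix k :: real
    show "ennreal (norm (indicator {0<..} k *\<^sub>R ((cmod (V k))\<^sup>2 / (2 * k * (exp (\<beta> * k) - 1))))) \<le>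
      ennreal (1 / (2 * k)) * ennreal (1 / (exp (\<beta> * k) - 1) * ((cmod (V k))\<^sup>2 + (cmod (V (- k)))\<^sup>2)) * indicator {0<..} k"
    proof (cases "k > 0")
      case True
      then have E: "exp (\<beta> * k) - 1 > 0" using \<open>\<beta> > 0\<close> by simp
      \<comment> \<open>Dropping the nonnegative term at -k is harmless, since the test integral
        only sees V on the positive half-line.\<close>
      have "(cmod (V k))\<^sup>2 / (2 * k * (exp (\<beta> * k) - 1)) \<le>
          1 / (2 * k) * (1 / (exp (\<beta> * k) - 1) * ((cmod (V k))\<^sup>2 + (cmod (V (- k)))\<^sup>2))"
        using True E by (simp add: divide_right_mono)
      then show ?thesis
        using True E by (simp add: ennreal_mult[symmetric] ennreal_leI)
    qed simp
  qed
  also have "\<dots> = thermal_excess x \<beta> ft"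
    unfolding thermal_excess_def V_def[symmetric] by (subst nn_integral_half_line_measure) simp_all
  finally show "(\<integral>\<^sup>+k. ennreal (norm (indicator {0<..} k *\<^sub>R
      ((cmod (U_transform x ft k))\<^sup>2 / (2 * k * (exp (\<beta> * k) - 1))))) \<partial>lborel) < \<infinity>"
    using fin by (simp add: V_def)
next
  have [measurable]: "U_transform x ft \<in> borel_measurable borel"
    using assms(2,3) by (rule borel_measurable_U_transform)
  show "(\<lambda>k. indicator {0<..} k *\<^sub>R ((cmod (U_transform x ft k))\<^sup>2 / (2 * k * (exp (\<beta> * k) - 1)))) \<in> borel_measurable lborel"
    by measurable
qed

lemma weighted_AM_GM:
  fixes a b r :: real
  assumes "r > 0"
  shows "a * b \<le> r * b\<^sup>2 / 2 + a\<^sup>2 / (2 * r)"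
proof -
  have "0 \<le> (r * b - a)\<^sup>2 / (2 * r)" using assms by simp
  also have "\<dots> = r * b\<^sup>2 / 2 + a\<^sup>2 / (2 * r) - a * b"
    using assms by (simp add: field_simps power2_eq_square)
  finally show ?thesis by simp
qed

text \<open>Weighted AM-GM splits the integrand into \<open>V\<close> squared against the thermal
  weight and the squared test function against the reciprocal weight. The first part is integrable
  by assumption, the second is explicit.\<close>

lemma smoothing_integral_decay:
  assumes "\<beta> > 0" and V: "set_integrable lborel {0<..} (\<lambda>k. (cmod (V k))\<^sup>2 / (2 * k * (exp (\<beta> * k) - 1)))"
    and "2 * \<beta> \<le> exp x"
  shows "cmod (LINT k:{0<..}|lborel. of_real (smoothing (exp x) k) * V k) \<le>
    ((LINT k:{0<..}|lborel. (cmod (V k))\<^sup>2 / (2 * k * (exp (\<beta> * k) - 1))) / 2 + 128 * \<beta>) * exp (- x / 2)"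
proof -
  define s where "s = exp x"
  \<comment> \<open>The balancing parameter: the first part is of order \<rho>, the second of order
    1 / (\<rho> s), and these coincide because \<rho>^2 s = 1.\<close>
  define \<rho> where "\<rho> = exp (- x / 2)"
  have "s > 0" "\<rho> > 0" by (simp_all add: s_def \<rho>_def)
  define w where "w k = indicator {0<..} k *\<^sub>R ((cmod (V k))\<^sup>2 / (2 * k * (exp (\<beta> * k) - 1)))" for k :: real
  define e where "e k = indicator {0<..} k *\<^sub>R exp (- (s / 2) * k)" for k :: real
  have w: "integrable lborel w" using V by (simp add: w_def[abs_def] set_integrable_def)
  have e: "integrable lborel e" and e_eq: "(\<integral>k. e k \<partial>lborel) = 2 / s"
    using set_integrable_exp_neg[of "s / 2"] integral_exp_neg_half_line[of "s / 2"] \<open>s > 0\<close>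
    by (simp_all add: e_def[abs_def] set_integrable_def set_lebesgue_integral_def)
  have pointwise: "cmod (indicator {0<..} k *\<^sub>R (of_real (smoothing s k) * V k)) \<le>
      \<rho> / 2 * w k + 64 * \<beta> / \<rho> * e k" for k
  proof (cases "k > 0")
    case True
    define d where "d = 2 * k * (exp (\<beta> * k) - 1)"
    have "d > 0" using True \<open>\<beta> > 0\<close> by (simp add: d_def)
    \<comment> \<open>This is e^u - 1 \<le> u e^u with u = \<beta>k. It shows that the reciprocal
      weight \<open>d\<close> vanishes to second order at k = 0, at the price of a factor
      e^(\<beta>k).\<close>
    have "(1 - \<beta> * k) * exp (\<beta> * k) \<le> exp (- (\<beta> * k)) * exp (\<beta> * k)"
      using exp_ge_add_one_self[of "- (\<beta> * k)"] by (intro mult_right_mono) auto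
    then have "exp (\<beta> * k) - 1 \<le> \<beta> * k * exp (\<beta> * k)"
      by (simp add: algebra_simps flip: exp_add)
    then have "d \<le> 2 * k * (\<beta> * k * exp (\<beta> * k))"
      unfolding d_def using True by (intro mult_left_mono) auto
    then have "d * (smoothing s k)\<^sup>2 \<le> 2 * k * (\<beta> * k * exp (\<beta> * k)) * (smoothing s k)\<^sup>2"
      by (rule mult_right_mono) simp
    also have "\<dots> = 2 * \<beta> * exp (\<beta> * k) * (k * smoothing s k)\<^sup>2"
      by (simp add: power2_eq_square algebra_simps)
    also have "\<dots> \<le> 2 * \<beta> * exp (\<beta> * k) * (64 * exp (- s * k))"
      using smoothing_square_le[OF \<open>s > 0\<close> True] \<open>\<beta> > 0\<close> by (intro mult_left_mono) auto
    also have "\<dots> = 128 * \<beta> * exp (\<beta> * k - s * k)"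
      by (simp add: exp_diff exp_minus field_simps)
    also have "\<dots> \<le> 128 * \<beta> * e k"
    proof -
      \<comment> \<open>The largeness assumption on \<open>x\<close> lets half of the decay e^(-sk)
        absorb the growth e^(\<beta>k).\<close>
      have "2 * \<beta> * k \<le> s * k"
        using assms(3) True by (simp add: s_def mult_right_mono)
      then have "\<beta> * k - s * k \<le> - (s / 2) * k" by simp
      then show ?thesis using True \<open>\<beta> > 0\<close> by (simp add: e_def)
    qed
    finally have d_le: "d * (smoothing s k)\<^sup>2 \<le> 128 * \<beta> * e k" .
    have "\<bar>smoothing s k\<bar> * cmod (V k) \<le> (\<rho> / d) * (cmod (V k))\<^sup>2 / 2 + \<bar>smoothing s k\<bar>\<^sup>2 / (2 * (\<rho> / d))"
      using \<open>\<rho> > 0\<close> \<open>d > 0\<close> by (intro weighted_AM_GM) simp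
    also have "\<bar>smoothing s k\<bar>\<^sup>2 / (2 * (\<rho> / d)) = d * (smoothing s k)\<^sup>2 / (2 * \<rho>)" by simp
    also have "\<dots> \<le> 128 * \<beta> * e k / (2 * \<rho>)"
      using d_le \<open>\<rho> > 0\<close> by (intro divide_right_mono) auto
    also have "(\<rho> / d) * (cmod (V k))\<^sup>2 / 2 = \<rho> / 2 * w k" using True by (simp add: w_def d_def)
    finally show ?thesis using True by (simp add: norm_mult)
  qed (simp add: w_def e_def)
  have "cmod (LINT k:{0<..}|lborel. of_real (smoothing s k) * V k) \<le>
      (\<integral>k. cmod (indicator {0<..} k *\<^sub>R (of_real (smoothing s k) * V k)) \<partial>lborel)"
    unfolding set_lebesgue_integral_def by (rule integral_norm_bound)
  also have "\<dots> \<le> (\<integral>k. \<rho> / 2 * w k + 64 * \<beta> / \<rho> * e k \<partial>lborel)"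
  proof (rule integral_mono')
    show "integrable lborel (\<lambda>k. \<rho> / 2 * w k + 64 * \<beta> / \<rho> * e k)"
      using w e by (intro Bochner_Integration.integrable_add integrable_mult_right) auto
    show "0 \<le> \<rho> / 2 * w k + 64 * \<beta> / \<rho> * e k" for k
      using pointwise[of k] norm_ge_zero by (rule order_trans[rotated])
  qed (rule pointwise)
  also have "\<dots> = \<rho> / 2 * (\<integral>k. w k \<partial>lborel) + 64 * \<beta> / \<rho> * (2 / s)"
    using w e by (simp add: e_eq)
  also have "64 * \<beta> / \<rho> * (2 / s) = 128 * \<beta> * \<rho>"
  proof -
    have "\<rho> * \<rho> * s = 1" by (simp add: \<rho>_def s_def flip: exp_add)
    then show ?thesis using \<open>\<rho> > 0\<close> \<open>s > 0\<close> by (simp add: field_simps)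
  qed
  finally show ?thesis
    by (simp add: s_def \<rho>_def w_def set_lebesgue_integral_def algebra_simps)
qed

section \<open>Contradiction with the normalization\<close>

lemma position_wave_exists_imp_integrable:
  assumes "position_wave_exists ft y"
  shows "set_integrable lborel {0<..} ft"
proof -
  let ?e = "\<lambda>p. exp (\<i> * complex_of_real (p * y))"
  have int: "integrable lborel (\<lambda>p. indicator {0<..} p *\<^sub>R (ft p * ?e p))"
    using assms by (simp add: position_wave_exists_def set_integrable_def)
  have inv: "?e p * exp (- \<i> * complex_of_real (p * y)) = 1" for p
    by (simp flip: exp_add)
  \<comment> \<open>Undoing the unimodular phase expresses \<open>ft\<close> through the integrable
    function, which transfers measurability as well as integrability; existence at a single
    \<open>y\<close> is therefore enough.\<close>
  have eq: "indicator {0<..} p *\<^sub>R ft p =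
      (indicator {0<..} p *\<^sub>R (ft p * ?e p)) * exp (- \<i> * complex_of_real (p * y))" for p
    using inv[of p] by (simp add: mult.assoc)
  have "integrable lborel (\<lambda>p. (indicator {0<..} p *\<^sub>R (ft p * ?e p)) * exp (- \<i> * complex_of_real (p * y)))"
  proof (rule Bochner_Integration.integrable_bound[OF int])
    show "(\<lambda>p. (indicator {0<..} p *\<^sub>R (ft p * ?e p)) * exp (- \<i> * complex_of_real (p * y))) \<in> borel_measurable lborel"
      using borel_measurable_integrable[OF int] by (rule borel_measurable_times) measurable
  qed (simp add: norm_mult)
  then show ?thesis
    unfolding set_integrable_def by (simp only: eq)
qed

lemma integral_half_line_measure_eq_0:
  fixes g :: "real \<Rightarrow> real"
  assumes "AE p in lborel. 0 < p \<longrightarrow> g p = 0"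
  shows "(\<integral>p. g p \<partial>half_line_measure) = 0"
proof (rule integral_eq_zero_AE)
  have "AE p in restrict_space lborel {0<..}. g p = 0"
    using assms by (simp add: AE_restrict_space_iff)
  then show "AE p in half_line_measure. g p = 0"
    unfolding half_line_measure_def
    by (subst AE_density) (auto intro!: measurable_restrict_space1)
qed

lemma thermal_excess_black_hole_infinite:
  assumes norm: "normalized ft"
    and ex: "position_wave_exists ft y"
    and int: "integrable lborel (position_wave ft)"
    and "\<beta> > 0"
  shows "thermal_excess black_hole_x \<beta> ft = \<infinity>"
proof (rule ccontr)
  assume "thermal_excess black_hole_x \<beta> ft \<noteq> \<infinity>"
  then have fin: "thermal_excess black_hole_x \<beta> ft < \<infinity>"
    by (simp add: less_top)
  have [measurable]: "black_hole_x \<in> borel_measurable borel"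
    unfolding black_hole_x_def[abs_def] by measurable
  have ft: "set_integrable lborel {0<..} ft"
    using ex by (rule position_wave_exists_imp_integrable)
  then have F: "integrable lborel (\<lambda>p. indicator {0<..} p *\<^sub>R ft p)"
    by (simp add: set_integrable_def)
  define a where "a p = (indicator {0<..} p *\<^sub>R ft p) * kernel_transform (of_real p)" for p
  define c where "c = 1 / sqrt (2 * pi)"
  have "c > 0" by (simp add: c_def)
  define M where "M = (\<integral>y. cmod (position_wave ft y) \<partial>lborel)"
  have "M \<ge> 0" by (simp add: M_def)
  define V where "V = U_transform black_hole_x ft"
  define I where "I = (LINT k:{0<..}|lborel. (cmod (V k))\<^sup>2 / (2 * k * (exp (\<beta> * k) - 1)))"
  have "I \<ge> 0"
    unfolding I_def set_lebesgue_integral_def using \<open>\<beta> > 0\<close>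
    by (intro integral_nonneg_AE) (auto simp: indicator_def)
  define h where "h x = (LINT k:{0<..}|lborel. of_real (smoothing (exp x) k) * V k)" for x
  have h_kernel: "h x = of_real c * (\<integral>y. position_wave ft y * mellin_kernel (x + y) \<partial>lborel)" for x
    unfolding h_def V_def c_def using int by (rule integral_smoothing_U_transform)
  have h_a: "h x = of_real (c * c) * (\<integral>p. a p * exp (- \<i> * of_real (p * x)) \<partial>lborel)" for x
    unfolding h_kernel integral_position_wave_kernel[OF ft] a_def c_def[symmetric] by simp
  have h_bounded: "cmod (h x) \<le> c * M" for x
  proof -
    have "cmod (\<integral>y. position_wave ft y * mellin_kernel (x + y) \<partial>lborel) \<le>
        (\<integral>y. cmod (position_wave ft y * mellin_kernel (x + y)) \<partial>lborel)"
      by (rule integral_norm_bound)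
    also have "\<dots> \<le> M"
      unfolding M_def
    proof (rule integral_mono')
      show "cmod (position_wave ft y * mellin_kernel (x + y)) \<le> cmod (position_wave ft y)" for y
        using order_trans[OF norm_kernel_le[of "x + y"], of 1]
        by (simp add: norm_mult mult_left_le)
    qed (use int in auto)
    finally show ?thesis using \<open>c > 0\<close> by (simp add: h_kernel norm_mult)
  qed
  \<comment> \<open>The first two summands come from \<open>smoothing_integral_decay\<close>. The
    last handles e^x < 2\<beta>, where \<open>sqrt (2 * \<beta>) * exp (- x / 2)\<close> is at least
    1.\<close>
  define C where "C = I / 2 + 128 * \<beta> + c * M * sqrt (2 * \<beta>)"
  have h_decay: "cmod (h x) \<le> C * exp (- x / 2)" for x
  proof (cases "2 * \<beta> \<le> exp x")
    case True
    have "cmod (h x) \<le> (I / 2 + 128 * \<beta>) * exp (- x / 2)"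
      unfolding h_def I_def
      using thermal_excess_finite_imp_integrable[OF \<open>\<beta> > 0\<close> _ int fin] \<open>\<beta> > 0\<close> True
      by (intro smoothing_integral_decay) (simp_all add: V_def)
    also have "\<dots> \<le> C * exp (- x / 2)"
      using \<open>c > 0\<close> \<open>M \<ge> 0\<close> \<open>\<beta> > 0\<close> by (intro mult_right_mono) (auto simp: C_def)
    finally show ?thesis .
  next
    case False
    have "exp x = (exp (x / 2))\<^sup>2" by (simp flip: exp_double)
    then have "exp (x / 2) \<le> sqrt (2 * \<beta>)"
      using False by (intro real_le_rsqrt) simp
    then have "exp (x / 2) * exp (- x / 2) \<le> sqrt (2 * \<beta>) * exp (- x / 2)"
      by (rule mult_right_mono) simp
    then have "1 \<le> sqrt (2 * \<beta>) * exp (- x / 2)" by (simp flip: exp_add)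
    then have "c * M * 1 \<le> c * M * (sqrt (2 * \<beta>) * exp (- x / 2))"
      using \<open>c > 0\<close> \<open>M \<ge> 0\<close> by (intro mult_left_mono) auto
    also have "\<dots> \<le> C * exp (- x / 2)"
      using \<open>I \<ge> 0\<close> \<open>\<beta> > 0\<close> unfolding C_def distrib_right mult.assoc by simp
    finally show ?thesis using h_bounded[of x] by simp
  qed
  have "AE p in lborel. a p = 0"
  proof (rule positive_frequency_exp_decay_imp_AE_0[where \<delta> = "1 / 2" and C = "C / (c * c)"])
    show "integrable lborel a"
    proof (rule Bochner_Integration.integrable_bound)
      show "integrable lborel (\<lambda>p. (\<integral>v. cmod (mellin_kernel v) \<partial>lborel) *\<^sub>R (indicator {0<..} p *\<^sub>R ft p))"
        using F by (rule integrable_scaleR_right)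
      show "a \<in> borel_measurable lborel"
        unfolding a_def[abs_def] using borel_measurable_integrable[OF F]
        by (rule borel_measurable_times) simp
      show "AE p in lborel. norm (a p) \<le> norm ((\<integral>v. cmod (mellin_kernel v) \<partial>lborel) *\<^sub>R (indicator {0<..} p *\<^sub>R ft p))"
        using norm_kernel_transform_le
        by (intro AE_I2) (auto simp: a_def norm_mult indicator_def mult.commute[of "cmod (ft _)"] intro!: mult_right_mono)
    qed
    show "cmod (\<integral>p. a p * exp (- \<i> * of_real (p * x)) \<partial>lborel) \<le> C / (c * c) * exp (- (1 / 2) * x)" for x
    proof -
      have "c * c * cmod (\<integral>p. a p * exp (- \<i> * of_real (p * x)) \<partial>lborel) \<le> C * exp (- x / 2)"
        using h_decay[of x] \<open>c > 0\<close> unfolding h_a norm_mult norm_of_real by simp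
      then show ?thesis using \<open>c > 0\<close> by (simp add: field_simps)
    qed
  qed (auto simp: a_def)
  \<comment> \<open>Off the null set of zeros of the transform, \<open>a p = 0\<close> forces
    \<open>ft p = 0\<close> for p > 0, so the norm of \<open>ft\<close> would be 0 instead of
    1.\<close>
  moreover have "AE p in lborel. p \<notin> {p::real. kernel_transform (of_real p) = 0}"
    using countable_zeros_kernel_transform by (intro AE_not_in countable_imp_null_set_lborel)
  ultimately have "AE p in lborel. 0 < p \<longrightarrow> (cmod (ft p))\<^sup>2 = 0"
    by eventually_elim (auto simp: a_def indicator_def)
  then have "(\<integral>p. (cmod (ft p))\<^sup>2 \<partial>half_line_measure) = 0"
    by (rule integral_half_line_measure_eq_0)
  then show False using norm by (simp add: normalized_def)
qed

theorem theorem21: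
  fixes ft :: "real \<Rightarrow> complex"
  assumes "wave_function ft"
    and "normalized ft"
    and "AE y in lborel. position_wave_exists ft y"
    and "integrable lborel (position_wave ft)"
  shows "\<forall>\<beta>>0. thermal_excess black_hole_x \<beta> ft = \<infinity> \<and> thermal_number black_hole_x \<beta> ft = \<infinity>"
proof (intro allI impI)
  fix \<beta> :: real assume "\<beta> > 0"
  \<comment> \<open>Existence almost everywhere gives existence somewhere, because the line has
    positive Lebesgue measure.\<close>
  obtain y where "position_wave_exists ft y"
  proof (rule ccontr)
    assume "\<not> thesis"
    then have "AE y in lborel. (y::real) \<in> {}" using assms(3) that by auto
    then have "emeasure lborel (UNIV :: real set) = 0"
      by (subst (asm) AE_iff_measurable[where N = UNIV]) auto
    then show False by simp
  qed
  then have excess: "thermal_excess black_hole_x \<beta> ft = \<infinity>"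
    using assms \<open>\<beta> > 0\<close> by (intro thermal_excess_black_hole_infinite)
  have "black_hole_x \<in> borel_measurable borel"
    unfolding black_hole_x_def[abs_def] by measurable
  \<comment> \<open>The sum is taken in the extended nonnegative reals, so an infinite excess makes
    it infinite whether or not the spontaneous number is finite.\<close>
  then have "thermal_number black_hole_x \<beta> ft = spontaneous_number black_hole_x ft + thermal_excess black_hole_x \<beta> ft"
    using assms \<open>\<beta> > 0\<close> by (intro thermal_number_decomp)
  then show "thermal_excess black_hole_x \<beta> ft = \<infinity> \<and> thermal_number black_hole_x \<beta> ft = \<infinity>"
    using excess by simp
qed

end
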